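(* $$\Omega(d+\log n)\;\le\; Q^{\parallel}\big(\mathrm{HAM}_n^{(d)}\big)\;\le\; O\big(d\,\log n\cdot\min(d,\log n)\big).$$
   Context: For $x,y\in\{0,1\}^n$ let $\Delta(x,y)$ denote their Hamming distance. The Hamming distance problem is the Boolean function $\mathrm{HAM}^{(d)}_n:\{0,1\}^n\times\{0,1\}^n\to\{0,1\}$ with $\mathrm{HAM}^{(d)}_n(x,y)=1$ if and only if $\Delta(x,y)\le d$. $Q^{\parallel}(f)$ is the quantum communication complexity of $f$ in the simultaneous message passing model with worst-case error probability $1/3$: Alice (holding $x$) and Bob (holding $y$) each send one quantum message, a possibly mixed state depending only on their own input (private randomness is allowed), to a referee, who measures the joint (tensor product) state and outputs a bit which must equal $f(x,y)$ with probability at least $2/3$ for every input. There is no public coin and no shared entanglement. The cost of a protocol is the total number of qubits sent for a worst-case input, and $Q^{\parallel}(f)$ is the minimum cost of such a protocol.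
   Formalization: The lower bound is stated for d ≤ αn with any fixed α < 1 (its constant depends on α), as it fails e.g. for d ≥ n, where the function is constant; the upper bound is stated for d ≥ 1, as at d = 0 its right-hand side is 0. *)

theory Defs
  imports Complex_Main "Jordan_Normal_Form.Matrix" "Jordan_Normal_Form.Conjugate"
    "Jordan_Normal_Form.Schur_Decomposition"
begin

definition bitstrings :: "nat \<Rightarrow> bool list set" where
  "bitstrings n = {x. length x = n}"

definition hamming_dist :: "'a list \<Rightarrow> 'a list \<Rightarrow> nat" where
  "hamming_dist x y = card {i. i < length x \<and> x ! i \<noteq> y ! i}"

(* The length n is carried by the input domain bitstrings n of the communication problem. *)
definition HAM :: "nat \<Rightarrow> bool list \<Rightarrow> bool list \<Rightarrow> bool" where
  "HAM d x y \<longleftrightarrow> hamming_dist x y \<le> d"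

definition mat_trace :: "'a::comm_monoid_add mat \<Rightarrow> 'a" where
  "mat_trace A = (\<Sum>i<dim_row A. A $$ (i, i))"

definition tensor_mat :: "'a::times mat \<Rightarrow> 'a mat \<Rightarrow> 'a mat" where
  "tensor_mat A B =
     mat (dim_row A * dim_row B) (dim_col A * dim_col B)
       (\<lambda>(i, j). A $$ (i div dim_row B, j div dim_col B) * B $$ (i mod dim_row B, j mod dim_col B))"

(* In the order on the complex numbers used here, 0 \<le> z means that z is real and nonnegative. *)
definition positive_semidef :: "nat \<Rightarrow> complex mat \<Rightarrow> bool" where
  "positive_semidef N A \<longleftrightarrow>
     A \<in> carrier_mat N N \<and> mat_adjoint A = A \<and> (\<forall>v \<in> carrier_vec N. 0 \<le> (A *\<^sub>v v) \<bullet>c v)"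

definition density_matrix :: "nat \<Rightarrow> complex mat \<Rightarrow> bool" where
  "density_matrix N \<rho> \<longleftrightarrow> positive_semidef N \<rho> \<and> mat_trace \<rho> = 1"

definition binary_POVM :: "nat \<Rightarrow> (bool \<Rightarrow> complex mat) \<Rightarrow> bool" where
  "binary_POVM N M \<longleftrightarrow> (\<forall>b. positive_semidef N (M b)) \<and> M False + M True = 1\<^sub>m N"

definition outcome_prob :: "(bool \<Rightarrow> complex mat) \<Rightarrow> complex mat \<Rightarrow> bool \<Rightarrow> real" where
  "outcome_prob M \<rho> b = Re (mat_trace (M b * \<rho>))"

(* Private randomness of the players is absorbed in the mixed states, and that of the referee
   in the POVM; the states are indexed by the sender's own input only. *)
record ('a, 'b) smp_protocol =
  alice_qubits :: nat
  bob_qubits :: nat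
  alice_state :: "'a \<Rightarrow> complex mat"
  bob_state :: "'b \<Rightarrow> complex mat"
  referee :: "bool \<Rightarrow> complex mat"

definition valid_protocol :: "'a set \<Rightarrow> 'b set \<Rightarrow> ('a, 'b) smp_protocol \<Rightarrow> bool" where
  "valid_protocol X Y P \<longleftrightarrow>
     (\<forall>x\<in>X. density_matrix (2 ^ alice_qubits P) (alice_state P x)) \<and>
     (\<forall>y\<in>Y. density_matrix (2 ^ bob_qubits P) (bob_state P y)) \<and>
     binary_POVM (2 ^ (alice_qubits P + bob_qubits P)) (referee P)"

definition computes ::
  "'a set \<Rightarrow> 'b set \<Rightarrow> ('a, 'b) smp_protocol \<Rightarrow> ('a \<Rightarrow> 'b \<Rightarrow> bool) \<Rightarrow> bool" where
  "computes X Y P f \<longleftrightarrow>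
     (\<forall>x\<in>X. \<forall>y\<in>Y.
        outcome_prob (referee P) (tensor_mat (alice_state P x) (bob_state P y)) (f x y) \<ge> 2 / 3)"

definition protocol_cost :: "('a, 'b) smp_protocol \<Rightarrow> nat" where
  "protocol_cost P = alice_qubits P + bob_qubits P"

(* The minimum is over a nonempty set whenever X and Y are finite: each player can send the
   whole input as a computational basis state. *)
definition quantum_smp_complexity :: "'a set \<Rightarrow> 'b set \<Rightarrow> ('a \<Rightarrow> 'b \<Rightarrow> bool) \<Rightarrow> nat" where
  "quantum_smp_complexity X Y f =
     (LEAST c. \<exists>P. valid_protocol X Y P \<and> computes X Y P f \<and> protocol_cost P = c)"

abbreviation Q_HAM :: "nat \<Rightarrow> nat \<Rightarrow> nat" where
  "Q_HAM n d \<equiv> quantum_smp_complexity (bitstrings n) (bitstrings n) (HAM d)"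

end

(*
Lower bound. Fixing Bob's message turns a protocol into states rho_x of dimension N = 2^a and
effects E_y. The 2^n rows of the communication matrix are distinct, so the states stay distinct
after rounding their entries to precision 1/N^2; this forces N^2 log N = Omega(n). For the term d,
HAM contains the index problem on K = min(d, n - d) bits. There the observables A_i = 2 E_i - 1
satisfy |A_i| <= 1, and for every sign vector s the matrix sum_i s_i A_i has quadratic form at least
K/3 on some unit vector, whereas for random s the trace of its even powers is at most N times
the corresponding scalar moment of sum_i s_i. High moments give K = O(a).

Upper bound. Each player sends O(d log n) parities of the input, which determine the difference
of the two inputs if it has size at most d, and two fingerprints of log n + O(1) qubits built from
a code of small bias. The referee decodes a candidate difference e, turns Alice's fingerprint into
that of x + e by a diagonal sign matrix and compares it with Bob's by two swap tests. The cost
O(d log n) is below the claimed bound, since min(d, log n) >= 1 for n >= 2.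
*)
theory Submission
  imports Defs "HOL-Analysis.L2_Norm" "HOL-Library.FuncSet"
begin

subsection \<open>Positive semidefinite matrices\<close>

text \<open>Both lower bounds concern the number \<open>a\<close> of Alice's qubits alone, so they
  can be added. The obstacle in the second one is that passing to a trace loses the dimension factor
  \<open>N = 2 ^ a\<close>. This is affordable only when the moment order \<open>M\<close> is itself
  proportional to \<open>K\<close>: a constant-factor gap between \<open>K / 3\<close> and the scale
  \<open>M / t\<close> of the scalar moments, raised to the power \<open>M\<close>, then beats
  \<open>N\<close> unless \<open>K = O(a)\<close>. A Gram decomposition of positive matrices,
  quadratic forms and Cauchy-Schwarz stand in for eigenvalues.

  In the upper bound one swap test is not enough, because it accepts even orthogonal states with
  probability 1/2, above the permitted 1/3. Two tests square this value, and the result stays below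
  1/3 only if the bias of the code is at most about 0.39, hence the 3/8. The syndromes travel as
  basis states next to the fingerprints, so the referee measures a single projection that is block
  diagonal in the syndromes. All vectors and kernels of the protocol are real.\<close>

definition cip :: "nat \<Rightarrow> (nat \<Rightarrow> complex) \<Rightarrow> (nat \<Rightarrow> complex) \<Rightarrow> complex" where
  "cip N u v = (\<Sum>i<N. cnj (u i) * v i)"

definition app :: "nat \<Rightarrow> (nat \<Rightarrow> nat \<Rightarrow> complex) \<Rightarrow> (nat \<Rightarrow> complex) \<Rightarrow> nat \<Rightarrow> complex" where
  "app N A v = (\<lambda>i. \<Sum>j<N. A i j * v j)"

text \<open>Entry functions replace \<open>complex mat\<close>: only indices below \<open>N\<close>
  count and no carrier conditions arise. The symmetry clause makes the quadratic form real, so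
  testing its real part is full positivity.\<close>

definition psd :: "nat \<Rightarrow> (nat \<Rightarrow> nat \<Rightarrow> complex) \<Rightarrow> bool" where
  "psd N A \<longleftrightarrow> (\<forall>i<N. \<forall>j<N. A j i = cnj (A i j)) \<and> (\<forall>v. 0 \<le> Re (cip N v (app N A v)))"

definition nrm :: "nat \<Rightarrow> (nat \<Rightarrow> complex) \<Rightarrow> real" where
  "nrm N v = L2_set (\<lambda>i. cmod (v i)) {..<N}"

lemma cip_app: "cip N v (app N A v) = (\<Sum>i<N. \<Sum>j<N. cnj (v i) * A i j * v j)"
  by (simp add: cip_def app_def sum_distrib_left mult.assoc)

text \<open>Separates the pivot row and column, as needed to complete the square in
  \<open>gram_decomposition_aux\<close>.\<close>

lemma quad_form_insert:
  fixes A :: "nat \<Rightarrow> nat \<Rightarrow> complex" and v :: "nat \<Rightarrow> complex"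
  assumes "finite F" "a \<notin> F" and herm: "\<And>i j. i \<in> insert a F \<Longrightarrow> j \<in> insert a F \<Longrightarrow> A j i = cnj (A i j)"
  defines "\<beta> \<equiv> (\<Sum>j\<in>F. A a j * v j)"
  shows "(\<Sum>i\<in>insert a F. \<Sum>j\<in>insert a F. cnj (v i) * A i j * v j)
     = cnj (v a) * A a a * v a + cnj (v a) * \<beta> + v a * cnj \<beta> + (\<Sum>i\<in>F. \<Sum>j\<in>F. cnj (v i) * A i j * v j)"
proof -
  have "(\<Sum>i\<in>F. cnj (v i) * A i a * v a) = v a * cnj \<beta>"
    unfolding \<beta>_def cnj_sum sum_distrib_left
  proof (intro sum.cong refl)
    fix i assume "i \<in> F"
    then show "cnj (v i) * A i a * v a = v a * cnj (A a i * v i)" using herm[of a i] by simp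
  qed
  moreover have "(\<Sum>j\<in>F. cnj (v a) * A a j * v j) = cnj (v a) * \<beta>"
    by (simp add: \<beta>_def sum_distrib_left mult.assoc)
  ultimately show ?thesis
    using assms(1,2) by (simp add: sum.distrib algebra_simps)
qed

text \<open>Otherwise the vector with entry \<open>- t * A a b\<close> at \<open>a\<close> and
  \<open>1\<close> at \<open>b\<close> gives the form the real part
  \<open>Re (A b b) - 2 * t * n2\<close>, which is negative for large \<open>t\<close>.\<close>

lemma zero_diag_row:
  fixes A :: "nat \<Rightarrow> nat \<Rightarrow> complex"
  assumes "finite F" "a \<notin> F" "b \<in> F"
    and herm: "\<And>i j. i \<in> insert a F \<Longrightarrow> j \<in> insert a F \<Longrightarrow> A j i = cnj (A i j)"
    and pos: "\<And>v. 0 \<le> Re (\<Sum>i\<in>insert a F. \<Sum>j\<in>insert a F. cnj (v i) * A i j * v j)"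
    and zero: "A a a = 0"
  shows "A a b = 0"
proof (rule ccontr)
  assume nz: "A a b \<noteq> 0"
  define n2 where "n2 = (cmod (A a b))\<^sup>2"
  have n2: "n2 > 0" using nz by (simp add: n2_def)
  define t where "t = (\<bar>Re (A b b)\<bar> + 1) / n2"
  define v where "v = (\<lambda>i. if i = a then - (complex_of_real t) * A a b else if i = b then 1 else 0)"
  have ab: "a \<noteq> b" using assms(2,3) by auto
  have \<beta>: "(\<Sum>j\<in>F. A a j * v j) = A a b"
  proof -
    have "(\<Sum>j\<in>F. A a j * v j) = (\<Sum>j\<in>F. if j = b then A a b else 0)"
      by (intro sum.cong) (use assms(2) in \<open>auto simp: v_def\<close>)
    then show ?thesis using assms(1,3) by simp
  qed
  have q: "(\<Sum>i\<in>F. \<Sum>j\<in>F. cnj (v i) * A i j * v j) = A b b"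
  proof -
    have "(\<Sum>i\<in>F. \<Sum>j\<in>F. cnj (v i) * A i j * v j) = (\<Sum>i\<in>F. if i = b then (\<Sum>j\<in>F. if j = b then A b b else 0) else 0)"
      by (intro sum.cong) (use assms(2) in \<open>auto simp: v_def intro!: sum.cong\<close>)
    then show ?thesis using assms(1,3) by simp
  qed
  have "0 \<le> Re (cnj (v a) * A a b + v a * cnj (A a b) + A b b)"
    using pos[of v] by (simp only: quad_form_insert[of F a A v, OF assms(1,2) herm] \<beta> q zero mult_zero_left mult_zero_right add_0)
  also have "cnj (v a) * A a b + v a * cnj (A a b) = - of_real (2 * t * n2)"
    using complex_norm_square[of "A a b"]
    by (simp add: v_def n2_def mult_ac flip: of_real_power)
  finally have "2 * (t * n2) \<le> Re (A b b)" by simp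
  moreover have "t * n2 = \<bar>Re (A b b)\<bar> + 1" using n2 by (simp add: t_def)
  ultimately show False by linarith
qed

text \<open>Cholesky decomposition by symmetric elimination. A zero pivot needs no separate case,
  because division by zero then leaves the rest of the matrix unchanged.\<close>

lemma gram_decomposition_aux:
  fixes A :: "nat \<Rightarrow> nat \<Rightarrow> complex"
  assumes "finite F"
    and "\<And>i j. i \<in> F \<Longrightarrow> j \<in> F \<Longrightarrow> A j i = cnj (A i j)"
    and "\<And>v. 0 \<le> Re (\<Sum>i\<in>F. \<Sum>j\<in>F. cnj (v i) * A i j * v j)"
  shows "\<exists>W. \<forall>i\<in>F. \<forall>j\<in>F. A i j = (\<Sum>k\<in>F. W k i * cnj (W k j))"
  using assms
proof (induction F arbitrary: A rule: finite_induct)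
  case empty
  then show ?case by simp
next
  case (insert a F)
  note herm = insert.prems(1) and pos = insert.prems(2)
  define \<alpha> where "\<alpha> = Re (A a a)"
  have "A a a = cnj (A a a)" using herm[of a a] by simp
  then have Aaa: "A a a = of_real \<alpha>" unfolding \<alpha>_def by (simp add: complex_eq_iff)
  have "\<alpha> \<ge> 0"
  proof -
    define e :: "nat \<Rightarrow> complex" where "e = (\<lambda>i. if i = a then 1 else 0)"
    have "(\<Sum>j\<in>F. A a j * e j) = 0" "(\<Sum>i\<in>F. \<Sum>j\<in>F. cnj (e i) * A i j * e j) = 0"
      using insert.hyps by (auto simp: e_def intro!: sum.neutral)
    moreover have "e a = 1" by (simp add: e_def)
    ultimately have "(\<Sum>i\<in>insert a F. \<Sum>j\<in>insert a F. cnj (e i) * A i j * e j) = A a a"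
      by (subst quad_form_insert[OF insert.hyps herm]) (simp_all del: sum.insert)
    then show ?thesis using pos[of e] by (simp only: \<alpha>_def)
  qed
  \<comment> \<open>The Schur complement of the pivot.\<close>
  define A' where "A' = (\<lambda>i j. A i j - A i a * A a j / of_real \<alpha>)"
  have hermF: "A j i = cnj (A i j)" if "i \<in> insert a F" "j \<in> insert a F" for i j
    using herm that by blast
  have "\<exists>W. \<forall>i\<in>F. \<forall>j\<in>F. A' i j = (\<Sum>k\<in>F. W k i * cnj (W k j))"
  proof (rule insert.IH)
    fix i j assume "i \<in> F" "j \<in> F"
    then show "A' j i = cnj (A' i j)"
      unfolding A'_def using hermF[of i j] hermF[of i a] hermF[of j a] by (simp add: mult.commute)
  next
    fix v :: "nat \<Rightarrow> complex"
    define \<beta> where "\<beta> = (\<Sum>j\<in>F. A a j * v j)"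
    \<comment> \<open>This entry at \<open>a\<close> minimises the form of \<open>A\<close> when the
      other entries are those of \<open>v\<close>; the minimum is the form of \<open>A'\<close> at
      \<open>v\<close>.\<close>
    define w where "w = v(a := - \<beta> / of_real \<alpha>)"
    have \<beta>w: "(\<Sum>j\<in>F. A a j * w j) = \<beta>"
      unfolding \<beta>_def w_def by (intro sum.cong) (use insert.hyps in auto)
    have Qw: "(\<Sum>i\<in>F. \<Sum>j\<in>F. cnj (w i) * A i j * w j) = (\<Sum>i\<in>F. \<Sum>j\<in>F. cnj (v i) * A i j * v j)"
      unfolding w_def by (intro sum.cong) (use insert.hyps in auto)
    have \<beta>': "(\<Sum>i\<in>F. cnj (v i) * A i a) = cnj \<beta>"
      unfolding \<beta>_def cnj_sum
    proof (intro sum.cong refl)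
      fix i assume "i \<in> F"
      then show "cnj (v i) * A i a = cnj (A a i * v i)" using hermF[of a i] by simp
    qed
    have "(\<Sum>i\<in>F. \<Sum>j\<in>F. cnj (v i) * A' i j * v j)
       = (\<Sum>i\<in>F. \<Sum>j\<in>F. cnj (v i) * A i j * v j - (cnj (v i) * A i a) * (A a j * v j) / of_real \<alpha>)"
      by (intro sum.cong refl) (simp add: A'_def left_diff_distrib right_diff_distrib)
    also have "\<dots> = (\<Sum>i\<in>F. \<Sum>j\<in>F. cnj (v i) * A i j * v j)
       - (\<Sum>i\<in>F. \<Sum>j\<in>F. (cnj (v i) * A i a) * (A a j * v j)) / of_real \<alpha>"
      by (simp only: sum_subtractf sum_divide_distrib)
    also have "(\<Sum>i\<in>F. \<Sum>j\<in>F. (cnj (v i) * A i a) * (A a j * v j)) = cnj \<beta> * \<beta>"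
      unfolding sum_product[symmetric] \<beta>' by (simp add: \<beta>_def)
    also have "(\<Sum>i\<in>F. \<Sum>j\<in>F. cnj (v i) * A i j * v j) - cnj \<beta> * \<beta> / of_real \<alpha>
       = (\<Sum>i\<in>insert a F. \<Sum>j\<in>insert a F. cnj (w i) * A i j * w j)"
    proof -
      have "(\<Sum>i\<in>insert a F. \<Sum>j\<in>insert a F. cnj (w i) * A i j * w j)
        = cnj (w a) * A a a * w a + cnj (w a) * \<beta> + w a * cnj \<beta> + (\<Sum>i\<in>F. \<Sum>j\<in>F. cnj (v i) * A i j * v j)"
        by (simp only: quad_form_insert[of F a A w, OF insert.hyps herm] \<beta>w Qw)
      moreover have "w a = - \<beta> / of_real \<alpha>" by (simp add: w_def)
      ultimately show ?thesis
        by (cases "\<alpha> = 0") (simp_all add: Aaa)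
    qed
    finally show "0 \<le> Re (\<Sum>i\<in>F. \<Sum>j\<in>F. cnj (v i) * A' i j * v j)" using pos[of w] by simp
  qed
  then obtain W where W: "\<And>i j. i \<in> F \<Longrightarrow> j \<in> F \<Longrightarrow> A' i j = (\<Sum>k\<in>F. W k i * cnj (W k j))" by blast
  define W' where "W' = (\<lambda>k i. if k = a then A i a / of_real (sqrt \<alpha>) else if i = a then 0 else W k i)"
  have sq: "complex_of_real (sqrt \<alpha>) * complex_of_real (sqrt \<alpha>) = of_real \<alpha>"
    using \<open>\<alpha> \<ge> 0\<close> by (simp flip: of_real_mult)
  \<comment> \<open>For a zero pivot this says that its whole row vanishes, which again comes from
    positivity.\<close>
  have row: "A a j = A a a * A a j / of_real \<alpha>" if "j \<in> insert a F" for j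
  proof (cases "\<alpha> = 0")
    case True
    have "A a j = 0"
    proof (cases "j = a")
      case False
      with that have "j \<in> F" by simp
      from zero_diag_row[OF insert.hyps this herm pos] True Aaa show ?thesis by simp
    qed (use True Aaa in simp)
    then show ?thesis by simp
  next
    case False
    then show ?thesis by (simp add: Aaa)
  qed
  have "A i j = (\<Sum>k\<in>insert a F. W' k i * cnj (W' k j))" if ij: "i \<in> insert a F" "j \<in> insert a F" for i j
  proof -
    have 1: "W' a i * cnj (W' a j) = A i a * A a j / of_real \<alpha>"
      using hermF[of a j] hermF[of j a] ij by (simp add: W'_def sq)
    have 2: "(\<Sum>k\<in>F. W' k i * cnj (W' k j)) = (if i = a \<or> j = a then 0 else A' i j)"
    proof (cases "i = a \<or> j = a")
      case True
      then show ?thesis using insert.hyps by (auto simp: W'_def intro!: sum.neutral)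
    next
      case False
      then show ?thesis using insert.hyps ij by (subst W) (auto simp: W'_def intro!: sum.cong)
    qed
    have 3: "A i a = A i a * A a a / of_real \<alpha>"
    proof -
      have "A i a = cnj (A a i)" using hermF[of a i] ij by simp
      also have "\<dots> = cnj (A a a * A a i / of_real \<alpha>)" using row[OF ij(1)] by simp
      also have "\<dots> = A i a * A a a / of_real \<alpha>" using hermF[of a i] ij Aaa by simp
      finally show ?thesis .
    qed
    show ?thesis
      using insert.hyps 1 2 3 row[OF ij(2)] by (auto simp: A'_def)
  qed
  then show ?case by blast
qed

lemma psd_cnj: "psd N A \<Longrightarrow> i < N \<Longrightarrow> j < N \<Longrightarrow> cnj (A i j) = A j i"
  unfolding psd_def by metis

lemma psd_nonneg: "psd N A \<Longrightarrow> 0 \<le> Re (cip N v (app N A v))"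
  unfolding psd_def by blast

lemma gram_decomposition:
  assumes "psd N A"
  obtains W where "\<And>i j. i < N \<Longrightarrow> j < N \<Longrightarrow> A i j = (\<Sum>k<N. W k i * cnj (W k j))"
proof -
  have "\<exists>W. \<forall>i\<in>{..<N}. \<forall>j\<in>{..<N}. A i j = (\<Sum>k\<in>{..<N}. W k i * cnj (W k j))"
  proof (rule gram_decomposition_aux)
    fix v
    show "0 \<le> Re (\<Sum>i<N. \<Sum>j<N. cnj (v i) * A i j * v j)"
      using psd_nonneg[OF assms, of v] by (simp only: cip_app)
  qed (simp_all add: psd_cnj[OF assms])
  then show ?thesis using that by (metis lessThan_iff)
qed

text \<open>Apply \<open>2 * x * y \<le> x^2 + y^2\<close> to each term of a Gram decomposition.
  Entries of states and effects are thereby at most 1 in modulus, which limits both the range of the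
  rounded values and the effect of rounding errors.\<close>

lemma psd_entry_le:
  assumes "psd N A" "i < N" "j < N"
  shows "2 * cmod (A i j) \<le> Re (A i i) + Re (A j j)"
proof -
  obtain W where W: "\<And>i j. i < N \<Longrightarrow> j < N \<Longrightarrow> A i j = (\<Sum>k<N. W k i * cnj (W k j))"
    using gram_decomposition[OF assms(1)] by blast
  have d: "Re (A i i) = (\<Sum>k<N. (cmod (W k i))\<^sup>2)" if "i < N" for i
  proof -
    have "Re (z * cnj z) = (cmod z)\<^sup>2" for z
      unfolding cmod_power2 by (simp add: power2_eq_square)
    then show ?thesis using that by (simp only: W Re_sum)
  qed
  have "cmod (A i j) \<le> (\<Sum>k<N. cmod (W k i) * cmod (W k j))"
    unfolding W[OF assms(2,3)] by (rule sum_norm_le) (simp add: norm_mult)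
  then have "2 * cmod (A i j) \<le> (\<Sum>k<N. 2 * cmod (W k i) * cmod (W k j))"
    unfolding mult.assoc sum_distrib_left[symmetric] by simp
  also have "\<dots> \<le> (\<Sum>k<N. (cmod (W k i))\<^sup>2 + (cmod (W k j))\<^sup>2)"
    by (rule sum_mono) (rule sum_squares_bound)
  also have "\<dots> = Re (A i i) + Re (A j j)"
    by (simp only: d[OF assms(2)] d[OF assms(3)] sum.distrib)
  finally show ?thesis .
qed

lemma psd_diag_nonneg: "psd N A \<Longrightarrow> i < N \<Longrightarrow> 0 \<le> Re (A i i)"
  using psd_entry_le[of N A i i] norm_ge_zero[of "A i i"] by linarith

section \<open>Inner products, norms and contractions\<close>

lemma cip_diff_right: "cip N u (\<lambda>i. v i - w i) = cip N u v - cip N u w"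
  by (simp add: cip_def algebra_simps sum_subtractf)

lemma cip_diff_left: "cip N (\<lambda>i. v i - w i) u = cip N v u - cip N w u"
  by (simp add: cip_def algebra_simps sum_subtractf)

lemma cip_scale_right: "cip N u (\<lambda>i. c * v i) = c * cip N u v"
  by (simp add: cip_def sum_distrib_left algebra_simps)

lemma cnj_cip: "cnj (cip N u v) = cip N v u"
  by (simp add: cip_def mult.commute)

lemma cip_self: "cip N v v = of_real ((nrm N v)\<^sup>2)"
proof -
  have "cnj z * z = of_real ((cmod z)\<^sup>2)" for z by (metis complex_norm_square mult.commute)
  then show ?thesis by (simp only: cip_def nrm_def L2_set_def sum_nonneg real_sqrt_pow2 zero_le_power2 of_real_sum)
qed

lemma nrm_nonneg [simp]: "0 \<le> nrm N v"
  by (simp add: nrm_def)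

lemma cip_le: "cmod (cip N u v) \<le> nrm N u * nrm N v"
proof -
  have "cmod (cip N u v) \<le> (\<Sum>i<N. \<bar>cmod (u i)\<bar> * \<bar>cmod (v i)\<bar>)"
    unfolding cip_def by (rule sum_norm_le) (simp add: norm_mult)
  also have "\<dots> \<le> nrm N u * nrm N v"
    unfolding nrm_def by (rule L2_set_mult_ineq)
  finally show ?thesis .
qed

lemma nrm_triangle: "nrm N (\<lambda>i. u i + v i) \<le> nrm N u + nrm N v"
proof -
  have "nrm N (\<lambda>i. u i + v i) \<le> L2_set (\<lambda>i. cmod (u i) + cmod (v i)) {..<N}"
    unfolding nrm_def by (intro L2_set_mono) (auto intro: norm_triangle_ineq)
  also have "\<dots> \<le> nrm N u + nrm N v"
    unfolding nrm_def by (rule L2_set_triangle_ineq)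
  finally show ?thesis .
qed

lemma nrm_sum_le: "nrm N (\<lambda>i. \<Sum>k\<in>K. f k i) \<le> (\<Sum>k\<in>K. nrm N (f k))"
proof (induction K rule: infinite_finite_induct)
  case (insert k K)
  then show ?case
    using nrm_triangle[of N "f k" "\<lambda>i. \<Sum>k\<in>K. f k i"] by simp
qed (simp_all add: nrm_def L2_set_def)

lemma nrm_scale: "nrm N (\<lambda>i. c * v i) = cmod c * nrm N v"
  by (simp add: nrm_def norm_mult L2_set_right_distrib)

lemma cip_app_adjoint:
  assumes "\<And>i j. i < N \<Longrightarrow> j < N \<Longrightarrow> cnj (A i j) = A j i"
  shows "cip N u (app N A v) = cip N (app N A u) v"
proof -
  have "cip N (app N A u) v = (\<Sum>i<N. \<Sum>j<N. cnj (A i j) * cnj (u j) * v i)"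
    by (simp add: cip_def app_def sum_distrib_right)
  also have "\<dots> = (\<Sum>i<N. \<Sum>j<N. cnj (u j) * A j i * v i)"
    by (intro sum.cong refl) (simp add: assms)
  also have "\<dots> = (\<Sum>j<N. \<Sum>i<N. cnj (u j) * A j i * v i)"
    by (rule sum.swap)
  also have "\<dots> = cip N u (app N A v)"
    by (simp add: cip_def app_def sum_distrib_left mult.assoc)
  finally show ?thesis by simp
qed

lemma app_diff: "app N A (\<lambda>i. v i - w i) = (\<lambda>i. app N A v i - app N A w i)"
  by (simp add: app_def algebra_simps sum_subtractf)

lemma app_add_left: "app N (\<lambda>i j. A i j + B i j) v i = app N A v i + app N B v i"
  by (simp add: app_def distrib_right sum.distrib)

lemma app_scale_left: "app N (\<lambda>i j. c * A i j) v i = c * app N A v i"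
  by (simp add: app_def sum_distrib_left mult.assoc)

lemma app_id: "i < N \<Longrightarrow> app N (\<lambda>i j. of_bool (i = j)) v i = v i"
proof -
  assume "i < N"
  have "(\<Sum>j<N. of_bool (i = j) * v j) = (\<Sum>j<N. if j = i then v j else 0)"
    by (intro sum.cong) auto
  with \<open>i < N\<close> show ?thesis by (simp add: app_def)
qed

lemma app_id_diff: "i < N \<Longrightarrow> app N (\<lambda>i j. of_bool (i = j) - M i j) v i = v i - app N M v i"
  using app_add_left[of N "\<lambda>i j. of_bool (i = j)" "\<lambda>i j. (-1) * M i j" v i]
  by (simp add: app_scale_left[of N "-1", simplified] app_id)

lemma cip_cong: "(\<And>i. i < N \<Longrightarrow> v i = w i) \<Longrightarrow> cip N u v = cip N u w"
  by (simp add: cip_def)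

text \<open>The identity \<open>M - M\<^sup>2 = M(1 - M)M + (1 - M)M(1 - M)\<close> shows \<open>M\<^sup>2 \<le> M\<close>, so \<open>(2M - 1)\<^sup>2 \<le> 1\<close>.\<close>

lemma effect_contraction:
  assumes M: "psd N M" and M': "psd N (\<lambda>i j. of_bool (i = j) - M i j)"
  shows "nrm N (app N (\<lambda>i j. 2 * M i j - of_bool (i = j)) v) \<le> nrm N v"
proof -
  define u where "u = app N M v"
  define w where "w = (\<lambda>i. v i - u i)"
  have adj: "cip N a (app N M b) = cip N (app N M a) b" for a b
    by (rule cip_app_adjoint) (simp add: psd_cnj[OF M])
  have "cip N u (app N (\<lambda>i j. of_bool (i = j) - M i j) u) = cip N u (\<lambda>i. u i - app N M u i)"
    by (rule cip_cong) (rule app_id_diff)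
  then have 1: "0 \<le> Re (cip N u u - cip N u (app N M u))"
    using psd_nonneg[OF M', of u] by (simp add: cip_diff_right)
  have 2: "0 \<le> Re (cip N w (app N M w))" by (rule psd_nonneg[OF M])
  have "cip N w (app N M w) = cip N v u - cip N v (app N M u) - (cip N u u - cip N u (app N M u))"
    unfolding w_def app_diff cip_diff_right cip_diff_left by (simp add: u_def)
  also have "cip N v (app N M u) = cip N u u" by (simp add: adj u_def)
  finally have 3: "Re (cip N u u) \<le> Re (cip N v u)" using 1 2 by simp
  define z where "z = (\<lambda>i. 2 * u i - v i)"
  have "app N (\<lambda>i j. 2 * M i j - of_bool (i = j)) v i = z i" if "i < N" for i
    using app_add_left[of N "\<lambda>i j. 2 * M i j" "\<lambda>i j. (-1) * of_bool (i = j)" v i]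
      app_scale_left[of N 2 M v i] app_scale_left[of N "-1" "\<lambda>i j. of_bool (i = j)" v i] app_id[OF that]
    by (simp add: z_def u_def)
  then have nz: "nrm N (app N (\<lambda>i j. 2 * M i j - of_bool (i = j)) v) = nrm N z"
    unfolding nrm_def by (intro L2_set_cong) auto
  have right: "cip N a z = 2 * cip N a u - cip N a v" for a
    unfolding z_def cip_diff_right cip_scale_right ..
  have left: "Re (cip N z a) = 2 * Re (cip N u a) - Re (cip N v a)" for a
    using arg_cong[OF right[of a], of "\<lambda>x. Re (cnj x)"] by (simp only: complex_cnj_diff complex_cnj_mult cnj_cip) simp
  have "Re (cip N z z) = 4 * Re (cip N u u) - 2 * Re (cip N u v) - 2 * Re (cip N v u) + Re (cip N v v)"
    using right[of z] left[of u] left[of v] by simp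
  moreover have "Re (cip N u v) = Re (cip N v u)"
    using cnj_cip[of N u v] by (metis cnj.sel(1))
  ultimately have "Re (cip N z z) \<le> Re (cip N v v)" using 3 by simp
  then have "(nrm N z)\<^sup>2 \<le> (nrm N v)\<^sup>2" unfolding cip_self by (simp flip: of_real_power)
  then show ?thesis unfolding nz by (rule power2_le_imp_le) simp
qed

subsection \<open>From simultaneous messages to one-way protocols\<close>

lemma sum_lessThan_mult:
  fixes f :: "nat \<Rightarrow> 'a :: comm_monoid_add"
  shows "(\<Sum>p<N * B. f p) = (\<Sum>i<N. \<Sum>j<B. f (i * B + j))"
proof -
  have "(\<Sum>p<N * B. f p) = (\<Sum>i<N. sum f {i * B..<i * B + B})"
    by (rule sum.nat_group[symmetric])
  also have "\<dots> = (\<Sum>i<N. \<Sum>j<B. f (i * B + j))"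
  proof (rule sum.cong[OF refl])
    fix i
    show "sum f {i * B..<i * B + B} = (\<Sum>j<B. f (i * B + j))"
      using sum.shift_bounds_nat_ivl[of f 0 "i * B" B] by (simp add: lessThan_atLeast0 add.commute)
  qed
  finally show ?thesis .
qed

lemma mat_adjoint_index:
  fixes A :: "complex mat"
  assumes "A \<in> carrier_mat m n" "i < n" "j < m"
  shows "mat_adjoint A $$ (i, j) = cnj (A $$ (j, i))"
  using assms unfolding mat_adjoint_def by (simp add: mat_of_rows_index cols_def)

lemma positive_semidef_psd:
  assumes "positive_semidef N A"
  shows "psd N (\<lambda>i j. A $$ (i, j))"
  unfolding psd_def
proof (intro conjI allI impI)
  have A: "A \<in> carrier_mat N N" and adj: "mat_adjoint A = A"
    and pos: "\<And>v. v \<in> carrier_vec N \<Longrightarrow> 0 \<le> (A *\<^sub>v v) \<bullet>c v"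
    using assms unfolding positive_semidef_def by auto
  show "A $$ (j, i) = cnj (A $$ (i, j))" if "i < N" "j < N" for i j
    using mat_adjoint_index[OF A that(2,1)] adj by simp
  show "0 \<le> Re (cip N v (app N (\<lambda>i j. A $$ (i, j)) v))" for v
  proof -
    have "(A *\<^sub>v vec N v) \<bullet>c vec N v = cip N v (app N (\<lambda>i j. A $$ (i, j)) v)"
      using A by (simp add: scalar_prod_def cip_def app_def lessThan_atLeast0 mult.commute)
    then show ?thesis using pos[of "vec N v"] by (simp add: less_eq_complex_def)
  qed
qed

text \<open>The partial trace over Bob's register of \<open>G\<close> times (identity tensor
  \<open>\<sigma>\<close>); \<open>i * B + j\<close> is the index of the pair \<open>(i, j)\<close>
  in \<open>tensor_mat\<close>.\<close>

definition slice :: "nat \<Rightarrow> (nat \<Rightarrow> nat \<Rightarrow> complex) \<Rightarrow> (nat \<Rightarrow> nat \<Rightarrow> complex) \<Rightarrow> nat \<Rightarrow> nat \<Rightarrow> complex" where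
  "slice B G \<sigma> i i' = (\<Sum>j<B. \<Sum>j'<B. G (i * B + j) (i' * B + j') * \<sigma> j' j)"

lemma pair_index_less: "i < N \<Longrightarrow> j < B \<Longrightarrow> i * B + j < N * (B::nat)"
  by (metis add.commute add_mult_distrib less_eq_Suc_le mult_Suc mult_le_mono1 nat_add_left_cancel_less
      order_less_le_trans)

lemma pair_index_eq_iff:
  fixes B :: nat
  assumes "j < B" "j' < B"
  shows "i * B + j = i' * B + j' \<longleftrightarrow> i = i' \<and> j = j'"
proof
  assume h: "i * B + j = i' * B + j'"
  show "i = i' \<and> j = j'"
    using arg_cong[OF h, of "\<lambda>x. x div B"] arg_cong[OF h, of "\<lambda>x. x mod B"] assms by simp
qed auto

text \<open>If \<open>\<sigma>\<close> is the sum of the rank-one matrices of vectors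
  \<open>W k\<close>, the form of the slice at \<open>v\<close> is the sum of the forms of
  \<open>G\<close> at the product vectors of \<open>v\<close> and \<open>W k\<close>.\<close>

lemma psd_slice:
  assumes G: "psd (N * B) G" and \<sigma>: "psd B \<sigma>"
  shows "psd N (slice B G \<sigma>)"
  unfolding psd_def
proof (intro conjI allI impI)
  fix i i' assume "i < N" "i' < N"
  have "cnj (slice B G \<sigma> i i') = (\<Sum>j<B. \<Sum>j'<B. G (i' * B + j') (i * B + j) * \<sigma> j j')"
    unfolding slice_def cnj_sum complex_cnj_mult
    by (intro sum.cong refl arg_cong2[where f = times] psd_cnj[OF G] psd_cnj[OF \<sigma>])
      (use \<open>i < N\<close> \<open>i' < N\<close> in \<open>auto intro: pair_index_less\<close>)
  also have "\<dots> = slice B G \<sigma> i' i"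
    unfolding slice_def by (rule sum.swap)
  finally show "slice B G \<sigma> i' i = cnj (slice B G \<sigma> i i')" ..
next
  fix v
  obtain W where W: "\<And>i j. i < B \<Longrightarrow> j < B \<Longrightarrow> \<sigma> i j = (\<Sum>k<B. W k i * cnj (W k j))"
    using gram_decomposition[OF \<sigma>] by blast
  define t where "t k p = v (p div B) * W k (p mod B)" for k p
  have t: "t k (i * B + j) = v i * W k j" if "j < B" for k i j
    using that by (simp add: t_def)
  have "cip N v (app N (slice B G \<sigma>) v)
    = (\<Sum>i<N. \<Sum>i'<N. \<Sum>j<B. \<Sum>j'<B. \<Sum>k<B. cnj (t k (i * B + j)) * G (i * B + j) (i' * B + j') * t k (i' * B + j'))"
    unfolding cip_app slice_def sum_distrib_left sum_distrib_right
    by (intro sum.cong refl) (simp add: W t sum_distrib_left sum_distrib_right mult_ac)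
  also have "\<dots> = (\<Sum>i<N. \<Sum>j<B. \<Sum>i'<N. \<Sum>j'<B. \<Sum>k<B. cnj (t k (i * B + j)) * G (i * B + j) (i' * B + j') * t k (i' * B + j'))"
    by (rule sum.cong[OF refl]) (rule sum.swap)
  also have "\<dots> = (\<Sum>p<N * B. \<Sum>q<N * B. \<Sum>k<B. cnj (t k p) * G p q * t k q)"
    unfolding sum_lessThan_mult ..
  also have "\<dots> = (\<Sum>p<N * B. \<Sum>k<B. \<Sum>q<N * B. cnj (t k p) * G p q * t k q)"
    by (rule sum.cong[OF refl]) (rule sum.swap)
  also have "\<dots> = (\<Sum>k<B. cip (N * B) (t k) (app (N * B) G (t k)))"
    unfolding cip_app by (rule sum.swap)
  finally show "0 \<le> Re (cip N v (app N (slice B G \<sigma>) v))"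
    by (simp add: Re_sum sum_nonneg psd_nonneg[OF G])
qed

lemma trace_tensor:
  assumes M: "M \<in> carrier_mat (N * B) (N * B)" and \<rho>: "\<rho> \<in> carrier_mat N N" and \<sigma>: "\<sigma> \<in> carrier_mat B B"
  shows "mat_trace (M * tensor_mat \<rho> \<sigma>)
    = (\<Sum>i<N. \<Sum>i'<N. slice B (\<lambda>p q. M $$ (p, q)) (\<lambda>i j. \<sigma> $$ (i, j)) i i' * \<rho> $$ (i', i))"
proof -
  have "mat_trace (M * tensor_mat \<rho> \<sigma>)
    = (\<Sum>p<N * B. \<Sum>q<N * B. M $$ (p, q) * (\<rho> $$ (q div B, p div B) * \<sigma> $$ (q mod B, p mod B)))"
    using assms by (simp add: mat_trace_def tensor_mat_def scalar_prod_def lessThan_atLeast0)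
  also have "\<dots> = (\<Sum>i<N. \<Sum>j<B. \<Sum>i'<N. \<Sum>j'<B. M $$ (i * B + j, i' * B + j') * \<sigma> $$ (j', j) * \<rho> $$ (i', i))"
    unfolding sum_lessThan_mult by (intro sum.cong refl) simp
  also have "\<dots> = (\<Sum>i<N. \<Sum>i'<N. \<Sum>j<B. \<Sum>j'<B. M $$ (i * B + j, i' * B + j') * \<sigma> $$ (j', j) * \<rho> $$ (i', i))"
    by (rule sum.cong[OF refl]) (rule sum.swap)
  finally show ?thesis by (simp add: slice_def sum_distrib_right)
qed

lemma slice_id:
  assumes "i < N" "i' < N"
  shows "slice B (\<lambda>p q. of_bool (p = q)) \<sigma> i i' = of_bool (i = i') * (\<Sum>j<B. \<sigma> j j)"
proof -
  have "slice B (\<lambda>p q. of_bool (p = q)) \<sigma> i i' = (\<Sum>j<B. \<Sum>j'<B. if j' = j then of_bool (i = i') * \<sigma> j j else 0)"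
    unfolding slice_def by (intro sum.cong refl) (auto simp: pair_index_eq_iff)
  then show ?thesis by (simp add: sum_distrib_left)
qed

text \<open>Fixing Bob's message turns the referee's measurement into one on Alice's message alone.\<close>

lemma smp_one_way:
  assumes valid: "valid_protocol X Y P" and comp: "computes X Y P f"
  defines "N \<equiv> 2 ^ alice_qubits P"
  obtains \<rho> E where
    "\<And>x. x \<in> X \<Longrightarrow> psd N (\<rho> x)" "\<And>x. x \<in> X \<Longrightarrow> (\<Sum>i<N. \<rho> x i i) = 1"
    "\<And>y. y \<in> Y \<Longrightarrow> psd N (E y)" "\<And>y. y \<in> Y \<Longrightarrow> psd N (\<lambda>i j. of_bool (i = j) - E y i j)"
    "\<And>x y. x \<in> X \<Longrightarrow> y \<in> Y \<Longrightarrow> f x y \<Longrightarrow> 2/3 \<le> Re (\<Sum>i<N. \<Sum>j<N. E y i j * \<rho> x j i)"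
    "\<And>x y. x \<in> X \<Longrightarrow> y \<in> Y \<Longrightarrow> \<not> f x y \<Longrightarrow> Re (\<Sum>i<N. \<Sum>j<N. E y i j * \<rho> x j i) \<le> 1/3"
proof -
  define B :: nat where "B = 2 ^ bob_qubits P"
  have NB: "2 ^ (alice_qubits P + bob_qubits P) = N * B" by (simp add: N_def B_def power_add)
  let ?M = "referee P"
  define \<rho> where "\<rho> x = (\<lambda>i j. alice_state P x $$ (i, j))" for x
  define \<sigma> where "\<sigma> y = (\<lambda>i j. bob_state P y $$ (i, j))" for y
  define G where "G b = (\<lambda>p q. ?M b $$ (p, q))" for b
  define E where "E y = slice B (G True) (\<sigma> y)" for y
  have dx: "density_matrix N (alice_state P x)" if "x \<in> X" for x
    using valid that by (simp add: valid_protocol_def N_def)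
  have dy: "density_matrix B (bob_state P y)" if "y \<in> Y" for y
    using valid that by (simp add: valid_protocol_def B_def)
  have M: "positive_semidef (N * B) (?M b)" and M1: "?M False + ?M True = 1\<^sub>m (N * B)" for b
    using valid by (simp_all add: valid_protocol_def binary_POVM_def NB)
  have cM: "?M b \<in> carrier_mat (N * B) (N * B)" for b using M by (simp add: positive_semidef_def)
  have c\<rho>: "alice_state P x \<in> carrier_mat N N" if "x \<in> X" for x
    using dx[OF that] by (simp add: density_matrix_def positive_semidef_def)
  have c\<sigma>: "bob_state P y \<in> carrier_mat B B" if "y \<in> Y" for y
    using dy[OF that] by (simp add: density_matrix_def positive_semidef_def)
  have G: "psd (N * B) (G b)" for b unfolding G_def by (rule positive_semidef_psd[OF M])
  have \<sigma>: "psd B (\<sigma> y)" if "y \<in> Y" for y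
    unfolding \<sigma>_def using dy[OF that] by (simp add: density_matrix_def positive_semidef_psd)
  have \<rho>: "psd N (\<rho> x)" if "x \<in> X" for x
    unfolding \<rho>_def using dx[OF that] by (simp add: density_matrix_def positive_semidef_psd)
  have tr\<sigma>: "(\<Sum>j<B. \<sigma> y j j) = 1" if "y \<in> Y" for y
    using dy[OF that] c\<sigma>[OF that] by (simp add: density_matrix_def mat_trace_def \<sigma>_def)
  have tr\<rho>: "(\<Sum>i<N. \<rho> x i i) = 1" if "x \<in> X" for x
    using dx[OF that] c\<rho>[OF that] by (simp add: density_matrix_def mat_trace_def \<rho>_def)
  have GG: "G False p q + G True p q = of_bool (p = q)" if "p < N * B" "q < N * B" for p q
  proof -
    have "(?M False + ?M True) $$ (p, q) = of_bool (p = q)" unfolding M1 using that by simp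
    moreover have "(?M False + ?M True) $$ (p, q) = ?M False $$ (p, q) + ?M True $$ (p, q)"
      by (rule index_add_mat) (use cM[of True] that in auto)
    ultimately show ?thesis by (simp add: G_def)
  qed
  \<comment> \<open>Slicing is linear and sends the identity to the trace of
    \<open>\<sigma> y\<close>, which is 1, times the identity. Rejection thus becomes the
    complementary effect.\<close>
  have EE: "slice B (G False) (\<sigma> y) i i' = of_bool (i = i') - E y i i'" if "y \<in> Y" "i < N" "i' < N" for y i i'
  proof -
    have "slice B (G False) (\<sigma> y) i i' + E y i i'
      = (\<Sum>j<B. \<Sum>j'<B. (G False (i * B + j) (i' * B + j') + G True (i * B + j) (i' * B + j')) * \<sigma> y j' j)"
      by (simp add: E_def slice_def distrib_right sum.distrib)
    also have "\<dots> = slice B (\<lambda>p q. of_bool (p = q)) (\<sigma> y) i i'"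
      unfolding slice_def by (intro sum.cong refl) (use that GG pair_index_less in auto)
    also have "\<dots> = of_bool (i = i')" using slice_id[OF that(2,3)] tr\<sigma>[OF that(1)] by simp
    finally show ?thesis by (simp add: algebra_simps)
  qed
  have prob: "outcome_prob ?M (tensor_mat (alice_state P x) (bob_state P y)) b
     = Re (\<Sum>i<N. \<Sum>j<N. slice B (G b) (\<sigma> y) i j * \<rho> x j i)" if "x \<in> X" "y \<in> Y" for x y b
    unfolding outcome_prob_def trace_tensor[OF cM c\<rho>[OF that(1)] c\<sigma>[OF that(2)]] by (simp add: G_def \<sigma>_def \<rho>_def)
  have ok: "2/3 \<le> outcome_prob ?M (tensor_mat (alice_state P x) (bob_state P y)) (f x y)"
    if "x \<in> X" "y \<in> Y" for x y
    using comp that by (simp add: computes_def)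
  show ?thesis
  proof (rule that[of \<rho> E])
    fix y assume y: "y \<in> Y"
    show "psd N (E y)" unfolding E_def by (rule psd_slice[OF G \<sigma>[OF y]])
    have F: "psd N (slice B (G False) (\<sigma> y))" by (rule psd_slice[OF G \<sigma>[OF y]])
    show "psd N (\<lambda>i j. of_bool (i = j) - E y i j)"
    proof -
      have "(\<forall>i<N. \<forall>j<N. of_bool (j = i) - E y j i = cnj (of_bool (i = j) - E y i j))"
        using psd_cnj[OF F] EE[OF y] by metis
      moreover have "cip N v (app N (\<lambda>i j. of_bool (i = j) - E y i j) v) = cip N v (app N (slice B (G False) (\<sigma> y)) v)" for v
        unfolding cip_app by (intro sum.cong refl) (simp add: EE[OF y])
      ultimately show ?thesis unfolding psd_def using psd_nonneg[OF F] by metis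
    qed
  next
    fix x y assume x: "x \<in> X" and y: "y \<in> Y" and "f x y"
    then show "2/3 \<le> Re (\<Sum>i<N. \<Sum>j<N. E y i j * \<rho> x j i)"
      using ok[OF x y] prob[OF x y] by (simp add: E_def)
  next
    fix x y assume x: "x \<in> X" and y: "y \<in> Y" and "\<not> f x y"
    then have "2/3 \<le> Re (\<Sum>i<N. \<Sum>j<N. slice B (G False) (\<sigma> y) i j * \<rho> x j i)"
      using ok[OF x y] prob[OF x y] by simp
    also have "(\<Sum>i<N. \<Sum>j<N. slice B (G False) (\<sigma> y) i j * \<rho> x j i)
      = (\<Sum>i<N. \<Sum>j<N. (if j = i then \<rho> x i i else 0) - E y i j * \<rho> x j i)"
      by (intro sum.cong refl) (auto simp: EE[OF y] left_diff_distrib)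
    also have "\<dots> = 1 - (\<Sum>i<N. \<Sum>j<N. E y i j * \<rho> x j i)"
      using tr\<rho>[OF x] by (simp add: sum_subtractf)
    finally show "Re (\<Sum>i<N. \<Sum>j<N. E y i j * \<rho> x j i) \<le> 1/3" by simp
  qed (use \<rho> tr\<rho> in auto)
qed

section \<open>Rounding of states and the logarithmic lower bound\<close>

lemma density_entry_le:
  assumes "psd N \<rho>" "(\<Sum>i<N. \<rho> i i) = 1" "i < N" "j < N"
  shows "cmod (\<rho> i j) \<le> 1"
proof -
  have "Re (\<rho> k k) \<le> 1" if "k < N" for k
  proof -
    have "Re (\<rho> k k) \<le> (\<Sum>i<N. Re (\<rho> i i))"
      by (rule member_le_sum) (use that assms(1) in \<open>auto intro: psd_diag_nonneg\<close>)
    also have "\<dots> = 1" using arg_cong[OF assms(2), of Re] by simp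
    finally show ?thesis .
  qed
  from this[OF assms(3)] this[OF assms(4)] psd_entry_le[OF assms(1,3,4)] show ?thesis by linarith
qed

lemma effect_entry_le:
  assumes "psd N E" "psd N (\<lambda>i j. of_bool (i = j) - E i j)" "i < N" "j < N"
  shows "cmod (E i j) \<le> 1"
proof -
  have "Re (E k k) \<le> 1" if "k < N" for k
    using psd_diag_nonneg[OF assms(2) that] by simp
  from this[OF assms(3)] this[OF assms(4)] psd_entry_le[OF assms(1,3,4)] show ?thesis by linarith
qed

lemma floor_mult_eq_diff_le:
  fixes K s t :: real
  assumes "K > 0" "\<lfloor>K * s\<rfloor> = \<lfloor>K * t\<rfloor>"
  shows "\<bar>s - t\<bar> \<le> 1 / K"
proof -
  have "\<bar>K * s - K * t\<bar> \<le> 1" using assms(2) by linarith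
  also have "\<bar>K * s - K * t\<bar> = \<bar>s - t\<bar> * K"
    using assms(1) by (simp add: abs_mult mult.commute flip: right_diff_distrib)
  finally show ?thesis using assms(1) by (simp add: pos_le_divide_eq)
qed

text \<open>Rounding the entries of Alice's states to a grid that is fine enough for the referee not to
  notice, distinct rows of the communication matrix must lead to distinct rounded states.\<close>

lemma distinct_rows_card_le:
  assumes valid: "valid_protocol X Y P" and comp: "computes X Y P f"
    and rows: "\<And>x x'. x \<in> X \<Longrightarrow> x' \<in> X \<Longrightarrow> x \<noteq> x' \<Longrightarrow> \<exists>y\<in>Y. f x y \<noteq> f x' y"
  defines "N \<equiv> 2 ^ alice_qubits P"
  shows "card X \<le> (16 * N\<^sup>2 + 1) ^ (2 * N\<^sup>2)"
proof -
  obtain \<rho> E where \<rho>: "\<And>x. x \<in> X \<Longrightarrow> psd N (\<rho> x)" "\<And>x. x \<in> X \<Longrightarrow> (\<Sum>i<N. \<rho> x i i) = 1"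
    and E: "\<And>y. y \<in> Y \<Longrightarrow> psd N (E y)" "\<And>y. y \<in> Y \<Longrightarrow> psd N (\<lambda>i j. of_bool (i = j) - E y i j)"
    and yes: "\<And>x y. x \<in> X \<Longrightarrow> y \<in> Y \<Longrightarrow> f x y \<Longrightarrow> 2/3 \<le> Re (\<Sum>i<N. \<Sum>j<N. E y i j * \<rho> x j i)"
    and no: "\<And>x y. x \<in> X \<Longrightarrow> y \<in> Y \<Longrightarrow> \<not> f x y \<Longrightarrow> Re (\<Sum>i<N. \<Sum>j<N. E y i j * \<rho> x j i) \<le> 1/3"
    using smp_one_way[OF valid comp] unfolding N_def by blast
  \<comment> \<open>Rounding moves an entry by at most \<open>2 / K\<close>, and effects have
    entries of modulus at most 1, so the acceptance probability moves by at most
    \<open>2 * N^2 / K = 1/4\<close>, less than the gap 1/3. Each of the \<open>2 * N^2\<close> real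
    coordinates takes one of \<open>16 * N^2 + 1\<close> values.\<close>
  define K where "K = 8 * real N ^ 2"
  have Kpos: "K > 0" by (simp add: K_def N_def)
  define g where "g x = (\<lambda>(i, j)\<in>{..<N} \<times> {..<N}. (\<lfloor>K * Re (\<rho> x i j)\<rfloor>, \<lfloor>K * Im (\<rho> x i j)\<rfloor>))" for x
  define S where "S = {- 8 * int N ^ 2..8 * int N ^ 2}"
  have KS: "\<lfloor>K * t\<rfloor> \<in> S" if "\<bar>t\<bar> \<le> 1" for t
  proof -
    have "K * t \<le> K * 1" "K * (-1) \<le> K * t" 
      by (rule mult_left_mono; use that Kpos in linarith)+
    moreover have "K = of_int (8 * int N ^ 2)" by (simp add: K_def)
    ultimately have "- (8 * int N ^ 2) \<le> \<lfloor>K * t\<rfloor>" "\<lfloor>K * t\<rfloor> \<le> 8 * int N ^ 2"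
      by linarith+
    then show ?thesis by (simp add: S_def)
  qed
  have "g ` X \<subseteq> ({..<N} \<times> {..<N} \<rightarrow>\<^sub>E S \<times> S)"
  proof (intro image_subsetI PiE_I)
    fix x ij assume x: "x \<in> X" and ij: "ij \<in> {..<N} \<times> {..<N}"
    obtain i j where [simp]: "ij = (i, j)" by force
    have "cmod (\<rho> x i j) \<le> 1" using density_entry_le[OF \<rho>(1)[OF x] \<rho>(2)[OF x]] ij by simp
    then have "\<bar>Re (\<rho> x i j)\<bar> \<le> 1" "\<bar>Im (\<rho> x i j)\<bar> \<le> 1"
      using abs_Re_le_cmod abs_Im_le_cmod order_trans by blast+
    then show "g x ij \<in> S \<times> S" using ij KS by (simp add: g_def)
  qed (simp add: g_def)
  moreover have "inj_on g X"
  proof (rule inj_onI, rule ccontr)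
    fix x x' assume x: "x \<in> X" and x': "x' \<in> X" and eq: "g x = g x'" and "x \<noteq> x'"
    then obtain y where y: "y \<in> Y" "f x y \<noteq> f x' y" using rows by blast
    have diff: "cmod (\<rho> x j i - \<rho> x' j i) \<le> 2 / K" if "i < N" "j < N" for i j
    proof -
      have "\<lfloor>K * Re (\<rho> x j i)\<rfloor> = \<lfloor>K * Re (\<rho> x' j i)\<rfloor>" "\<lfloor>K * Im (\<rho> x j i)\<rfloor> = \<lfloor>K * Im (\<rho> x' j i)\<rfloor>"
        using fun_cong[OF eq, of "(j, i)"] that by (simp_all add: g_def)
      then have "\<bar>Re (\<rho> x j i - \<rho> x' j i)\<bar> \<le> 1 / K" "\<bar>Im (\<rho> x j i - \<rho> x' j i)\<bar> \<le> 1 / K"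
        using floor_mult_eq_diff_le[OF Kpos] by simp_all
      then show ?thesis using cmod_le[of "\<rho> x j i - \<rho> x' j i"] by simp
    qed
    have "\<bar>Re (\<Sum>i<N. \<Sum>j<N. E y i j * \<rho> x j i) - Re (\<Sum>i<N. \<Sum>j<N. E y i j * \<rho> x' j i)\<bar>
      \<le> cmod (\<Sum>i<N. \<Sum>j<N. E y i j * (\<rho> x j i - \<rho> x' j i))"
      using abs_Re_le_cmod[of "\<Sum>i<N. \<Sum>j<N. E y i j * (\<rho> x j i - \<rho> x' j i)"]
      by (simp only: right_diff_distrib sum_subtractf minus_complex.sel)
    also have "\<dots> \<le> (\<Sum>i<N. \<Sum>j<N. 1 * (2 / K))"
      by (intro sum_norm_le, unfold norm_mult, intro mult_mono)
        (auto intro!: effect_entry_le[OF E(1,2)[OF y(1)]] diff)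
    also have "\<dots> = 1/4" using Kpos by (auto simp add: K_def power2_eq_square N_def)
    finally show False
      using yes[OF x y(1)] no[OF x y(1)] yes[OF x' y(1)] no[OF x' y(1)] y(2) by (cases "f x y") auto
  qed
  ultimately have "card X \<le> card ({..<N} \<times> {..<N} \<rightarrow>\<^sub>E S \<times> S)"
    by (intro card_inj_on_le[of g]) (auto intro!: finite_PiE simp: S_def)
  also have "\<dots> = (card S * card S) ^ (N * N)"
    by (simp add: card_PiE card_cartesian_product)
  also have "card S = 16 * N\<^sup>2 + 1" by (simp add: S_def nat_add_distrib nat_mult_distrib nat_power_eq)
  also have "((16 * N\<^sup>2 + 1) * (16 * N\<^sup>2 + 1)) ^ (N * N) = (16 * N\<^sup>2 + 1) ^ (2 * N\<^sup>2)"
    by (simp only: power_mult flip: power2_eq_square)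
  finally show ?thesis .
qed

text \<open>With no qubits the only state is the scalar 1, so the referee cannot tell
  \<open>x\<close> from \<open>x'\<close>. The numerical bounds below use \<open>a \<ge> 1\<close>
  to absorb additive constants.\<close>

lemma distinct_rows_alice_pos:
  assumes valid: "valid_protocol X Y P" and comp: "computes X Y P f"
    and x: "x \<in> X" "x' \<in> X" "y \<in> Y" "f x y \<noteq> f x' y"
  shows "1 \<le> alice_qubits P"
proof (rule ccontr)
  assume "\<not> 1 \<le> alice_qubits P"
  then have N: "2 ^ alice_qubits P = (1::nat)" by simp
  obtain \<rho> E where "\<And>x. x \<in> X \<Longrightarrow> psd 1 (\<rho> x)" and tr: "\<And>x. x \<in> X \<Longrightarrow> (\<Sum>i<1. \<rho> x i i) = 1"
    and "\<And>y. y \<in> Y \<Longrightarrow> psd 1 (E y)" "\<And>y. y \<in> Y \<Longrightarrow> psd 1 (\<lambda>i j. of_bool (i = j) - E y i j)"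
    and yes: "\<And>x y. x \<in> X \<Longrightarrow> y \<in> Y \<Longrightarrow> f x y \<Longrightarrow> 2/3 \<le> Re (\<Sum>i<1. \<Sum>j<1. E y i j * \<rho> x j i)"
    and no: "\<And>x y. x \<in> X \<Longrightarrow> y \<in> Y \<Longrightarrow> \<not> f x y \<Longrightarrow> Re (\<Sum>i<1. \<Sum>j<1. E y i j * \<rho> x j i) \<le> 1/3"
    using smp_one_way[OF valid comp] unfolding N by blast
  have "\<rho> x 0 0 = 1" "\<rho> x' 0 0 = 1" using tr[OF x(1)] tr[OF x(2)] by simp_all
  then have eq: "(\<Sum>i<1. \<Sum>j<1. E y i j * \<rho> x j i) = (\<Sum>i<1. \<Sum>j<1. E y i j * \<rho> x' j i)"
    by simp
  show False
    using yes[OF x(1,3)] no[OF x(1,3)] yes[OF x(2,3)] no[OF x(2,3)] x(4) unfolding eq by (cases "f x y") auto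
qed

text \<open>Taking logarithms gives
  \<open>n \<le> (2 * a + 5) * (2 * N^2) \<le> 2 ^ (3 * a + 4)\<close>, and \<open>a \<ge> 1\<close>
  turns the exponent into \<open>7 * a\<close>.\<close>

lemma log_le_of_card_le:
  assumes "2 ^ n \<le> (16 * N\<^sup>2 + 1) ^ (2 * N\<^sup>2)" and N: "N = 2 ^ a" and "1 \<le> a" "1 \<le> n"
  shows "log 2 (real n) \<le> 7 * real a"
proof -
  have N2: "N\<^sup>2 = 2 ^ (2 * a)" by (simp add: N mult.commute flip: power_mult)
  have "16 * N\<^sup>2 + 1 \<le> (2::nat) ^ (2 * a + 5)"
    unfolding N2 power_add using one_le_power[of "2::nat" "2 * a"] by simp
  then have "(16 * N\<^sup>2 + 1) ^ (2 * N\<^sup>2) \<le> ((2::nat) ^ (2 * a + 5)) ^ (2 * N\<^sup>2)"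
    by (rule power_mono) simp
  with assms(1) have "(2::nat) ^ n \<le> 2 ^ ((2 * a + 5) * (2 * N\<^sup>2))"
    unfolding power_mult by (rule order_trans)
  then have "n \<le> (2 * a + 5) * (2 * N\<^sup>2)" by simp
  also have "\<dots> \<le> 8 * 2 ^ a * (2 * N\<^sup>2)"
    using \<open>1 \<le> a\<close> less_exp[of a] by (intro mult_right_mono) linarith+
  also have "8 * 2 ^ a * (2 * N\<^sup>2) = 2 ^ (3 * a + 4)"
  proof -
    have "3 * a + 4 = 3 + a + (1 + 2 * a)" by simp
    then show ?thesis unfolding N2 by (simp only: power_add) simp
  qed
  also have "(2::nat) ^ (3 * a + 4) \<le> 2 ^ (7 * a)" using \<open>1 \<le> a\<close> by (intro power_increasing) auto
  finally have "real n \<le> real (2 ^ (7 * a))" by (simp only: of_nat_le_iff)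
  then have "log 2 (real n) \<le> log 2 (real (2 ^ (7 * a)))"
    by (intro log_mono) (use \<open>1 \<le> n\<close> in simp_all)
  also have "\<dots> = 7 * real a" by simp
  finally show ?thesis .
qed

subsection \<open>The index problem\<close>

definition signs :: "nat \<Rightarrow> (nat \<Rightarrow> real) set" where
  "signs K = {..<K} \<rightarrow>\<^sub>E {1, -1}"

lemma card_signs: "card (signs K) = 2 ^ K"
  by (simp add: signs_def card_PiE numeral_2_eq_2)

lemma sum_signs_prod: "(\<Sum>x\<in>signs K. \<Prod>i<K. g i (x i)) = (\<Prod>i<K. g i 1 + g i (-1) :: real)"
  unfolding signs_def by (subst prod_sum_PiE[symmetric]) auto

text \<open>The sum factorises over the coordinates, and coordinate \<open>i\<close> contributes 2
  or 0 according to the parity of \<open>c i\<close>.\<close>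

lemma sum_signs_monomial_nonneg: "0 \<le> (\<Sum>x\<in>signs K. \<Prod>i<K. x i ^ c i)"
proof -
  have "0 \<le> 1 ^ k + (-1 :: real) ^ k" for k by (cases "even k") auto
  then show ?thesis
    unfolding sum_signs_prod[where g = "\<lambda>i s. s ^ c i"] by (intro prod_nonneg) auto
qed

text \<open>The subgaussian estimate with \<open>t^2\<close> in place of \<open>t^2 / 2\<close>. The
  bound on \<open>exp (- t)\<close> comes from
  \<open>(1 + t) * (1 - t + t^2) = 1 + t^3 \<ge> 1\<close>. It serves the moments here and the
  Chernoff bound for the code.\<close>

lemma two_cosh_le:
  fixes t :: real
  assumes "0 \<le> t" "t \<le> 1"
  shows "exp t + exp (- t) \<le> 2 * exp (t\<^sup>2)"
proof -
  have "exp t \<le> 1 + t + t\<^sup>2" using assms by (rule exp_bound)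
  moreover have "exp (- t) \<le> 1 - t + t\<^sup>2"
  proof -
    have "1 \<le> 1 + t ^ 3" using assms by simp
    also have "\<dots> = (1 + t) * (1 - t + t\<^sup>2)" by (simp add: algebra_simps power2_eq_square power3_eq_cube)
    also have "\<dots> \<le> exp t * (1 - t + t\<^sup>2)"
      using assms exp_ge_add_one_self[of t] by (intro mult_right_mono) auto
    finally show ?thesis by (simp add: exp_minus field_simps)
  qed
  ultimately show ?thesis using exp_ge_add_one_self[of "t\<^sup>2"] by linarith
qed

text \<open>A single term of the exponential series is at most its sum.\<close>

lemma even_power_le_exp:
  fixes s t :: real
  assumes "0 < t" "even m"
  shows "s ^ m \<le> fact m / t ^ m * (exp (t * s) + exp (- t * s))"
proof -
  have "s ^ m = \<bar>s\<bar> ^ m" using \<open>even m\<close> by (simp add: power_even_abs)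
  also have "\<dots> = fact m / t ^ m * ((t * \<bar>s\<bar>) ^ m / fact m)"
    using \<open>0 < t\<close> by (simp add: power_mult_distrib)
  also have "(t * \<bar>s\<bar>) ^ m / fact m \<le> exp (t * \<bar>s\<bar>)"
  proof -
    have "(\<Sum>n\<in>{m}. (t * \<bar>s\<bar>) ^ n /\<^sub>R fact n) \<le> (\<Sum>n. (t * \<bar>s\<bar>) ^ n /\<^sub>R fact n)"
      by (rule sum_le_suminf[OF summable_exp_generic]) (use \<open>0 < t\<close> in auto)
    then show ?thesis by (simp add: exp_def divide_inverse mult.commute)
  qed
  also have "exp (t * \<bar>s\<bar>) \<le> exp (t * s) + exp (- t * s)"
    by (cases "s \<ge> 0") auto
  finally show ?thesis using \<open>0 < t\<close> by (simp add: mult_left_mono divide_right_mono)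
qed

text \<open>The generating function factorises over the coordinates. The parameter \<open>t\<close>
  stays free, to be balanced against \<open>m\<close> and \<open>K\<close>.\<close>

lemma sum_signs_moment_le:
  assumes "0 < t" "t \<le> 1" "even m"
  shows "(\<Sum>x\<in>signs K. (\<Sum>i<K. x i) ^ m) \<le> 2 * (fact m / t ^ m) * (2 * exp (t\<^sup>2)) ^ K"
proof -
  have mgf: "(\<Sum>x\<in>signs K. exp (r * (\<Sum>i<K. x i))) = (exp r + exp (- r)) ^ K" for r :: real
    using sum_signs_prod[where K = K and g = "\<lambda>i s. exp (r * s)"]
    by (simp add: sum_distrib_left exp_sum)
  have "(\<Sum>x\<in>signs K. (\<Sum>i<K. x i) ^ m)
    \<le> (\<Sum>x\<in>signs K. fact m / t ^ m * (exp (t * (\<Sum>i<K. x i)) + exp (- t * (\<Sum>i<K. x i))))"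
    by (intro sum_mono even_power_le_exp assms)
  also have "\<dots> = 2 * (fact m / t ^ m) * (exp t + exp (- t)) ^ K"
    unfolding sum_distrib_left[symmetric] sum.distrib mgf by (simp add: add.commute)
  also have "\<dots> \<le> 2 * (fact m / t ^ m) * (2 * exp (t\<^sup>2)) ^ K"
    using assms by (intro mult_left_mono power_mono two_cosh_le) auto
  finally show ?thesis .
qed

section \<open>Powers of Hermitian operators and their traces\<close>

lemma iterate_adjoint:
  assumes "\<And>i j. i < N \<Longrightarrow> j < N \<Longrightarrow> cnj (B i j) = B j i"
  shows "cip N u ((app N B ^^ m) v) = cip N ((app N B ^^ m) u) v"
proof (induction m arbitrary: u)
  case (Suc m)
  have "cip N u ((app N B ^^ Suc m) v) = cip N (app N B u) ((app N B ^^ m) v)"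
    by (simp add: cip_app_adjoint[OF assms])
  also have "\<dots> = cip N ((app N B ^^ Suc m) u) v"
    by (simp add: Suc funpow_swap1)
  finally show ?case .
qed simp

text \<open>Log-convexity replaces an eigenvector: \<open>u (m+1)\<close> has squared norm equal to
  the inner product of \<open>u m\<close> and \<open>u (m+2)\<close>, so by Cauchy-Schwarz the
  ratios of consecutive norms never decrease, and the first ratio is at least
  \<open>c\<close>.\<close>

lemma iterate_nrm_ge:
  assumes herm: "\<And>i j. i < N \<Longrightarrow> j < N \<Longrightarrow> cnj (B i j) = B j i"
    and c: "0 < c" and w: "0 < nrm N w" and large: "c * (nrm N w)\<^sup>2 \<le> Re (cip N w (app N B w))"
  shows "c ^ m * nrm N w \<le> nrm N ((app N B ^^ m) w)"
proof -
  let ?u = "\<lambda>m. (app N B ^^ m) w"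
  have step: "0 < nrm N (?u m) \<and> c * nrm N (?u m) \<le> nrm N (?u (Suc m))" for m
  proof (induction m)
    case 0
    have "nrm N w * (c * nrm N w) \<le> Re (cip N w (app N B w))"
      using large by (simp add: power2_eq_square mult_ac)
    also have "\<dots> \<le> nrm N w * nrm N (app N B w)"
      using complex_Re_le_cmod cip_le by (rule order_trans)
    finally show ?case using w by simp
  next
    case (Suc m)
    have pos: "0 < nrm N (?u (Suc m))" using Suc c by (meson less_le_trans mult_pos_pos)
    have "cip N (?u (Suc m)) (?u (Suc m)) = cip N (?u m) (?u (Suc (Suc m)))"
      by (simp add: cip_app_adjoint[OF herm])
    then have "(nrm N (?u (Suc m)))\<^sup>2 = Re (cip N (?u m) (?u (Suc (Suc m))))"
      unfolding cip_self by (metis Re_complex_of_real)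
    also have "\<dots> \<le> nrm N (?u m) * nrm N (?u (Suc (Suc m)))"
      using complex_Re_le_cmod cip_le by (rule order_trans)
    finally have 1: "(nrm N (?u (Suc m)))\<^sup>2 \<le> nrm N (?u m) * nrm N (?u (Suc (Suc m)))" .
    have "nrm N (?u m) * (c * nrm N (?u (Suc m))) = (c * nrm N (?u m)) * nrm N (?u (Suc m))" by simp
    also have "\<dots> \<le> nrm N (?u (Suc m)) * nrm N (?u (Suc m))"
      using Suc by (intro mult_right_mono) auto
    finally have "nrm N (?u m) * (c * nrm N (?u (Suc m))) \<le> nrm N (?u m) * nrm N (?u (Suc (Suc m)))"
      using 1 by (simp add: power2_eq_square)
    then show ?case using Suc pos by simp
  qed
  show ?thesis
  proof (induction m)
    case (Suc m)
    have "c ^ Suc m * nrm N w \<le> c * nrm N (?u m)" using Suc c by simp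
    then show ?case using step[of m] by linarith
  qed simp
qed

definition unit :: "nat \<Rightarrow> nat \<Rightarrow> complex" where
  "unit b = (\<lambda>a. of_bool (a = b))"

lemma cip_unit: "b < N \<Longrightarrow> cip N (unit b) v = v b"
proof -
  assume "b < N"
  have "cip N (unit b) v = (\<Sum>a<N. if a = b then v b else 0)"
    unfolding cip_def unit_def by (intro sum.cong) auto
  with \<open>b < N\<close> show ?thesis by simp
qed

lemma nrm_unit: "b < N \<Longrightarrow> nrm N (unit b) = 1"
proof -
  assume "b < N"
  then have "complex_of_real ((nrm N (unit b))\<^sup>2) = of_real 1"
    unfolding cip_self[symmetric] by (simp add: cip_unit) (simp add: unit_def)
  then have "(nrm N (unit b))\<^sup>2 = 1" by (simp only: of_real_eq_iff)
  then show ?thesis using nrm_nonneg[of N "unit b"] by (simp add: power2_eq_1_iff)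
qed

text \<open>The trace of the power \<open>2 * m\<close> is the squared Frobenius norm of the
  \<open>m\<close>-th power, which dominates its squared operator norm and hence its growth on
  \<open>w\<close>.\<close>

lemma power_le_trace:
  assumes herm: "\<And>i j. i < N \<Longrightarrow> j < N \<Longrightarrow> cnj (B i j) = B j i"
    and c: "0 < c" and w: "0 < nrm N w" and large: "c * (nrm N w)\<^sup>2 \<le> Re (cip N w (app N B w))"
  shows "c ^ (2 * m) \<le> (\<Sum>b<N. Re (cip N (unit b) ((app N B ^^ (2 * m)) (unit b))))"
proof -
  let ?f = "app N B ^^ m"
  have tr: "Re (cip N (unit b) ((app N B ^^ (2 * m)) (unit b))) = (nrm N (?f (unit b)))\<^sup>2" for b
  proof -
    have "cip N (unit b) ((app N B ^^ (2 * m)) (unit b)) = cip N (unit b) (?f (?f (unit b)))"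
      by (simp add: mult_2 funpow_add)
    also have "\<dots> = cip N (?f (unit b)) (?f (unit b))"
      by (rule iterate_adjoint[OF herm])
    finally show ?thesis by (simp add: cip_self)
  qed
  have comp: "(cmod (?f w b))\<^sup>2 \<le> (nrm N (?f (unit b)))\<^sup>2 * (nrm N w)\<^sup>2" if "b < N" for b
  proof -
    have "cip N (unit b) (?f w) = cip N (?f (unit b)) w" by (rule iterate_adjoint[OF herm])
    then have "?f w b = cip N (?f (unit b)) w" by (simp only: cip_unit[OF that])
    then have "cmod (?f w b) \<le> nrm N (?f (unit b)) * nrm N w" by (simp add: cip_le)
    then have "(cmod (?f w b))\<^sup>2 \<le> (nrm N (?f (unit b)) * nrm N w)\<^sup>2" by (rule power_mono) simp
    then show ?thesis by (simp only: power_mult_distrib)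
  qed
  have "(c ^ m * nrm N w)\<^sup>2 \<le> (nrm N (?f w))\<^sup>2"
    using iterate_nrm_ge[OF herm c w large] c by (intro power_mono) auto
  also have "\<dots> = (\<Sum>b<N. (cmod (?f w b))\<^sup>2)"
    by (simp add: nrm_def L2_set_def sum_nonneg)
  also have "\<dots> \<le> (\<Sum>b<N. (nrm N (?f (unit b)))\<^sup>2 * (nrm N w)\<^sup>2)"
    by (intro sum_mono comp) auto
  finally have "c ^ (2 * m) * (nrm N w)\<^sup>2 \<le> (\<Sum>b<N. (nrm N (?f (unit b)))\<^sup>2) * (nrm N w)\<^sup>2"
    by (simp only: power_mult_distrib sum_distrib_right mult.commute[of 2 m] power_mult)
  then show ?thesis using w unfolding tr by simp
qed

text \<open>A noncommutative Khintchine inequality: expanding the power, the matrix coefficients have norm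
  at most one and the expectations of the sign monomials are nonnegative, so the scalar
  moments dominate.\<close>

lemma sign_sum_iterate_le:
  fixes A :: "nat \<Rightarrow> nat \<Rightarrow> nat \<Rightarrow> complex"
  assumes contr: "\<And>i v. i < K \<Longrightarrow> nrm N (app N (A i) v) \<le> nrm N v"
  defines "B \<equiv> \<lambda>x a b. \<Sum>i<K. of_real (x i) * A i a b"
  shows "nrm N (\<lambda>a. \<Sum>x\<in>signs K. of_real (\<Prod>i<K. x i ^ c i) * (app N (B x) ^^ m) v a)
     \<le> (\<Sum>x\<in>signs K. (\<Prod>i<K. x i ^ c i) * (\<Sum>i<K. x i) ^ m) * nrm N v"
\<comment> \<open>The monomial weight carries the signs already extracted: peeling off one factor
  \<open>B x\<close> applies some \<open>A i\<close> and raises the exponent \<open>c i\<close> by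
  one.\<close>
proof (induction m arbitrary: c)
  case 0
  have "nrm N (\<lambda>a. \<Sum>x\<in>signs K. of_real (\<Prod>i<K. x i ^ c i) * v a)
    = nrm N (\<lambda>a. of_real (\<Sum>x\<in>signs K. \<Prod>i<K. x i ^ c i) * v a)"
    by (simp only: sum_distrib_right of_real_sum)
  also have "\<dots> = (\<Sum>x\<in>signs K. \<Prod>i<K. x i ^ c i) * nrm N v"
    by (simp only: nrm_scale norm_of_real abs_of_nonneg[OF sum_signs_monomial_nonneg])
  finally show ?case by simp
next
  case (Suc m)
  define F where "F c = (\<lambda>a. \<Sum>x\<in>signs K. of_real (\<Prod>i<K. x i ^ c i) * (app N (B x) ^^ m) v a)" for c :: "nat \<Rightarrow> nat"
  have shift: "(\<Prod>l<K. x l ^ (c(i := Suc (c i))) l) = (\<Prod>l<K. x l ^ c l) * x i" if "i < K" for x :: "nat \<Rightarrow> real" and i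
  proof -
    have "(\<Prod>l<K. x l ^ (c(i := Suc (c i))) l) = (\<Prod>l<K. x l ^ c l * (if l = i then x i else 1))"
      by (intro prod.cong) auto
    then show ?thesis using that by (simp add: prod.distrib)
  qed
  have appB: "app N (B x) u a = (\<Sum>i<K. of_real (x i) * app N (A i) u a)" for x u a
  proof -
    have "app N (B x) u a = (\<Sum>b<N. \<Sum>i<K. of_real (x i) * (A i a b * u b))"
      by (simp add: app_def B_def sum_distrib_right mult.assoc)
    also have "\<dots> = (\<Sum>i<K. \<Sum>b<N. of_real (x i) * (A i a b * u b))" by (rule sum.swap)
    finally show ?thesis by (simp add: app_def sum_distrib_left)
  qed
  have "(\<Sum>x\<in>signs K. of_real (\<Prod>i<K. x i ^ c i) * (app N (B x) ^^ Suc m) v a)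
     = (\<Sum>i<K. app N (A i) (F (c(i := Suc (c i)))) a)" for a
  proof -
    have "(\<Sum>x\<in>signs K. of_real (\<Prod>i<K. x i ^ c i) * (app N (B x) ^^ Suc m) v a)
      = (\<Sum>x\<in>signs K. \<Sum>i<K. of_real (\<Prod>l<K. x l ^ (c(i := Suc (c i))) l) * app N (A i) ((app N (B x) ^^ m) v) a)"
      by (intro sum.cong refl) (simp add: appB sum_distrib_left shift mult.assoc del: fun_upd_apply)
    also have "\<dots> = (\<Sum>i<K. \<Sum>x\<in>signs K. of_real (\<Prod>l<K. x l ^ (c(i := Suc (c i))) l) * app N (A i) ((app N (B x) ^^ m) v) a)"
      by (rule sum.swap)
    also have "\<dots> = (\<Sum>i<K. app N (A i) (F (c(i := Suc (c i)))) a)"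
    proof (rule sum.cong[OF refl])
      fix i
      let ?g = "\<lambda>x. complex_of_real (\<Prod>l<K. x l ^ (c(i := Suc (c i))) l)"
      have "app N (A i) (F (c(i := Suc (c i)))) a = (\<Sum>b<N. \<Sum>x\<in>signs K. ?g x * (A i a b * (app N (B x) ^^ m) v b))"
        unfolding app_def[of N "A i"] F_def sum_distrib_left by (intro sum.cong refl) (simp only: mult.left_commute)
      also have "\<dots> = (\<Sum>x\<in>signs K. \<Sum>b<N. ?g x * (A i a b * (app N (B x) ^^ m) v b))" by (rule sum.swap)
      finally show "(\<Sum>x\<in>signs K. ?g x * app N (A i) ((app N (B x) ^^ m) v) a) = app N (A i) (F (c(i := Suc (c i)))) a"
        by (simp only: app_def[of N "A i"] sum_distrib_left)
    qed
    finally show ?thesis .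
  qed
  then have "nrm N (\<lambda>a. \<Sum>x\<in>signs K. of_real (\<Prod>i<K. x i ^ c i) * (app N (B x) ^^ Suc m) v a)
    = nrm N (\<lambda>a. \<Sum>i<K. app N (A i) (F (c(i := Suc (c i)))) a)" by simp
  also have "\<dots> \<le> (\<Sum>i<K. nrm N (app N (A i) (F (c(i := Suc (c i))))))"
    by (rule nrm_sum_le)
  also have "\<dots> \<le> (\<Sum>i<K. (\<Sum>x\<in>signs K. (\<Prod>l<K. x l ^ (c(i := Suc (c i))) l) * (\<Sum>i<K. x i) ^ m) * nrm N v)"
  proof (rule sum_mono)
    fix i assume "i \<in> {..<K}"
    then have "nrm N (app N (A i) (F (c(i := Suc (c i))))) \<le> nrm N (F (c(i := Suc (c i))))"
      by (intro contr) simp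
    also have "\<dots> \<le> (\<Sum>x\<in>signs K. (\<Prod>l<K. x l ^ (c(i := Suc (c i))) l) * (\<Sum>i<K. x i) ^ m) * nrm N v"
      unfolding F_def by (rule Suc)
    finally show "nrm N (app N (A i) (F (c(i := Suc (c i)))))
      \<le> (\<Sum>x\<in>signs K. (\<Prod>l<K. x l ^ (c(i := Suc (c i))) l) * (\<Sum>i<K. x i) ^ m) * nrm N v" .
  qed
  also have "\<dots> = (\<Sum>x\<in>signs K. (\<Prod>i<K. x i ^ c i) * (\<Sum>i<K. x i) ^ Suc m) * nrm N v"
  proof -
    have "(\<Sum>i<K. \<Sum>x\<in>signs K. (\<Prod>l<K. x l ^ (c(i := Suc (c i))) l) * (\<Sum>i<K. x i) ^ m)
      = (\<Sum>i<K. \<Sum>x\<in>signs K. (\<Prod>l<K. x l ^ c l) * x i * (\<Sum>i<K. x i) ^ m)"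
      by (intro sum.cong refl) (simp add: shift del: fun_upd_apply)
    also have "\<dots> = (\<Sum>x\<in>signs K. \<Sum>i<K. (\<Prod>l<K. x l ^ c l) * x i * (\<Sum>i<K. x i) ^ m)"
      by (rule sum.swap)
    also have "\<dots> = (\<Sum>x\<in>signs K. (\<Prod>i<K. x i ^ c i) * (\<Sum>i<K. x i) ^ Suc m)"
      by (simp add: sum_distrib_left[symmetric] sum_distrib_right[symmetric] mult.assoc)
    finally show ?thesis by (simp only: sum_distrib_right[symmetric])
  qed
  finally show ?case .
qed

text \<open>Sum the traces over all sign vectors. Each vector contributes at least
  \<open>c ^ (2 * m)\<close>, while after exchanging the sums each of the \<open>N\<close> diagonal
  entries is at most the scalar moment.\<close>

lemma sign_sum_moment_bound:
  fixes A :: "nat \<Rightarrow> nat \<Rightarrow> nat \<Rightarrow> complex" and c :: real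
  assumes herm: "\<And>i a b. i < K \<Longrightarrow> a < N \<Longrightarrow> b < N \<Longrightarrow> cnj (A i a b) = A i b a"
    and contr: "\<And>i v. i < K \<Longrightarrow> nrm N (app N (A i) v) \<le> nrm N v"
    and c: "0 < c"
  defines "B \<equiv> \<lambda>x a b. \<Sum>i<K. of_real (x i) * A i a b"
  assumes large: "\<And>x. x \<in> signs K \<Longrightarrow> \<exists>w. 0 < nrm N w \<and> c * (nrm N w)\<^sup>2 \<le> Re (cip N w (app N (B x) w))"
  shows "2 ^ K * c ^ (2 * m) \<le> real N * (\<Sum>x\<in>signs K. (\<Sum>i<K. x i) ^ (2 * m))"
proof -
  have hermB: "cnj (B x a b) = B x b a" if "a < N" "b < N" for x a b
    using that by (simp add: B_def herm)
  have "2 ^ K * c ^ (2 * m) = (\<Sum>x\<in>signs K. c ^ (2 * m))" by (simp add: card_signs)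
  also have "\<dots> \<le> (\<Sum>x\<in>signs K. \<Sum>b<N. Re (cip N (unit b) ((app N (B x) ^^ (2 * m)) (unit b))))"
  proof (rule sum_mono)
    fix x assume "x \<in> signs K"
    then obtain w where w: "0 < nrm N w" "c * (nrm N w)\<^sup>2 \<le> Re (cip N w (app N (B x) w))"
      using large by blast
    show "c ^ (2 * m) \<le> (\<Sum>b<N. Re (cip N (unit b) ((app N (B x) ^^ (2 * m)) (unit b))))"
      by (rule power_le_trace[OF _ c w]) (rule hermB)
  qed
  also have "\<dots> = (\<Sum>b<N. \<Sum>x\<in>signs K. Re (cip N (unit b) ((app N (B x) ^^ (2 * m)) (unit b))))"
    by (rule sum.swap)
  also have "\<dots> \<le> (\<Sum>b<N. \<Sum>x\<in>signs K. (\<Sum>i<K. x i) ^ (2 * m))"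
  proof (rule sum_mono)
    fix b assume "b \<in> {..<N}"
    then have b: "b < N" by simp
    define F where "F = (\<lambda>a. \<Sum>x\<in>signs K. of_real (\<Prod>i<K. x i ^ 0) * (app N (B x) ^^ (2 * m)) (unit b) a)"
    have "(\<Sum>x\<in>signs K. Re (cip N (unit b) ((app N (B x) ^^ (2 * m)) (unit b)))) = Re (cip N (unit b) F)"
      by (simp add: cip_unit[OF b] F_def)
    also have "\<dots> \<le> nrm N (unit b) * nrm N F"
      using complex_Re_le_cmod cip_le by (rule order_trans)
    also have "\<dots> \<le> (\<Sum>x\<in>signs K. (\<Sum>i<K. x i) ^ (2 * m))"
      using sign_sum_iterate_le[OF contr, where c = "\<lambda>_. 0" and m = "2 * m" and v = "unit b"]
      by (simp add: nrm_unit[OF b] F_def B_def)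
    finally show "(\<Sum>x\<in>signs K. Re (cip N (unit b) ((app N (B x) ^^ (2 * m)) (unit b))))
      \<le> (\<Sum>x\<in>signs K. (\<Sum>i<K. x i) ^ (2 * m))" .
  qed
  finally show ?thesis by simp
qed

lemma ln_2_ge_half: "1 / 2 \<le> ln (2 :: real)"
proof -
  have "exp (1 :: real) \<le> 2 ^ 2" using exp_le by simp
  then have "1 \<le> ln ((2 :: real) ^ 2)" by (metis exp_gt_zero ln_exp ln_le_cancel_iff order_less_le_trans)
  moreover have "ln (2 ^ 2) = 2 * ln (2 :: real)" by (subst ln_realpow) auto
  ultimately show ?thesis by linarith
qed

lemma sign_sum_dimension_bound:
  fixes A :: "nat \<Rightarrow> nat \<Rightarrow> nat \<Rightarrow> complex"
  assumes herm: "\<And>i a b. i < K \<Longrightarrow> a < N \<Longrightarrow> b < N \<Longrightarrow> cnj (A i a b) = A i b a"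
    and contr: "\<And>i v. i < K \<Longrightarrow> nrm N (app N (A i) v) \<le> nrm N v"
  defines "B \<equiv> \<lambda>x a b. \<Sum>i<K. of_real (x i) * A i a b"
  assumes large: "\<And>x. x \<in> signs K \<Longrightarrow>
      \<exists>w. 0 < nrm N w \<and> real K / 3 * (nrm N w)\<^sup>2 \<le> Re (cip N w (app N (B x) w))"
    and N: "N = 2 ^ a" and a: "1 \<le> a"
  shows "K \<le> 1300 * a"
proof (cases "K < 384")
  case True
  then show ?thesis using a by simp
next
  case False
  \<comment> \<open>\<open>M\<close> is at most \<open>K / 192\<close>, so with
    \<open>t = 1/32\<close> the scale \<open>M / t\<close> of the moments is at most half of
    \<open>K / 3\<close>. This yields the factor \<open>2 ^ M\<close>, against which stands only
    \<open>2 * N * exp (K / 1024)\<close>. For \<open>K < 384\<close> the order would be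
    zero.\<close>
  define m where "m = K div 384"
  define M where "M = 2 * m"
  define t :: real where "t = 1 / 32"
  have m: "1 \<le> m" "384 * m \<le> K" "K < 384 * (m + 1)"
    using False div_times_less_eq_dividend[of K 384] dividend_less_times_div[of 384 K]
    by (auto simp: m_def mult.commute)
  have M: "0 < M" "even M" using m by (auto simp: M_def)
  have "2 ^ K * (real K / 3) ^ M \<le> real N * (\<Sum>x\<in>signs K. (\<Sum>i<K. x i) ^ M)"
    unfolding M_def using False
    by (intro sign_sum_moment_bound[OF herm contr _ large[unfolded B_def]]) auto
  also have "\<dots> \<le> real N * (2 * (fact M / t ^ M) * (2 * exp (t\<^sup>2)) ^ K)"
    by (intro mult_left_mono sum_signs_moment_le M) (auto simp: t_def)
  also have "\<dots> \<le> real N * (2 * (real M ^ M / t ^ M) * (2 * exp (t\<^sup>2)) ^ K)"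
    using fact_le_power[of M, where 'a = real]
    by (intro mult_left_mono mult_right_mono divide_right_mono) (auto simp: t_def)
  also have "\<dots> = 2 ^ K * (2 * real N * exp (t\<^sup>2) ^ K * (real M / t) ^ M)"
    by (simp add: power_mult_distrib power_divide)
  finally have "(real K / 3) ^ M \<le> 2 * real N * exp (t\<^sup>2) ^ K * (real M / t) ^ M"
    by simp
  moreover have "2 * (real M / t) \<le> real K / 3"
    using m(2) by (simp add: t_def M_def)
  then have "(2 * (real M / t)) ^ M \<le> (real K / 3) ^ M"
    by (rule power_mono) (simp add: t_def)
  ultimately have "2 ^ M * (real M / t) ^ M \<le> 2 * real N * exp (t\<^sup>2) ^ K * (real M / t) ^ M"
    unfolding power_mult_distrib by linarith
  moreover have "0 < (real M / t) ^ M" using M by (simp add: t_def)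
  ultimately have "2 ^ M \<le> 2 * real N * exp (t\<^sup>2) ^ K"
    by (rule mult_right_le_imp_le)
  also have "\<dots> = 2 ^ Suc a * exp (real K / 1024)"
    by (simp add: N t_def power2_eq_square flip: exp_of_nat_mult)
  finally have "ln (2 ^ M) \<le> ln (2 ^ Suc a * exp (real K / 1024))" by (intro ln_mono) auto
  then have "real M * ln 2 \<le> real (Suc a) * ln 2 + real K / 1024"
    by (simp add: ln_mult ln_realpow distrib_right del: power_Suc)
  also have "real K / 1024 \<le> real K / 512 * ln 2"
    using mult_left_mono[OF ln_2_ge_half, of "real K / 512"] by simp
  finally have "real M * ln 2 \<le> (real (Suc a) + real K / 512) * ln 2"
    by (simp add: distrib_right)
  then have "real M \<le> real (Suc a) + real K / 512"
    by (rule mult_right_le_imp_le) simp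
  \<comment> \<open>Here \<open>M > K / 192 - 2\<close> and \<open>1/192 - 1/512 = 5/1536\<close>,
    so \<open>K < 308 * (a + 3)\<close>, and \<open>a \<ge> 1\<close>.\<close>
  then have "real K \<le> 1300 * real a" using m a by (simp add: M_def)
  then show ?thesis by linarith
qed

text \<open>The states \<open>\<rho> (xs s)\<close> form a quantum random access code for \<open>s\<close>. The constant is not optimal
  (Nayak's bound is \<open>K (1 - H(1/3))\<close>), but the proof avoids von Neumann entropy.\<close>

lemma index_qubits_bound:
  assumes valid: "valid_protocol X Y P" and comp: "computes X Y P f"
    and xs: "\<And>s. s \<in> signs K \<Longrightarrow> xs s \<in> X" and ys: "\<And>i. i < K \<Longrightarrow> ys i \<in> Y"
    and f: "\<And>s i. s \<in> signs K \<Longrightarrow> i < K \<Longrightarrow> f (xs s) (ys i) \<longleftrightarrow> s i = 1"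
    and a: "1 \<le> alice_qubits P"
  shows "K \<le> 1300 * alice_qubits P"
proof -
  define N :: nat where "N = 2 ^ alice_qubits P"
  obtain \<rho> E where \<rho>: "\<And>x. x \<in> X \<Longrightarrow> psd N (\<rho> x)" "\<And>x. x \<in> X \<Longrightarrow> (\<Sum>i<N. \<rho> x i i) = 1"
    and E: "\<And>y. y \<in> Y \<Longrightarrow> psd N (E y)" "\<And>y. y \<in> Y \<Longrightarrow> psd N (\<lambda>i j. of_bool (i = j) - E y i j)"
    and yes: "\<And>x y. x \<in> X \<Longrightarrow> y \<in> Y \<Longrightarrow> f x y \<Longrightarrow> 2/3 \<le> Re (\<Sum>i<N. \<Sum>j<N. E y i j * \<rho> x j i)"
    and no: "\<And>x y. x \<in> X \<Longrightarrow> y \<in> Y \<Longrightarrow> \<not> f x y \<Longrightarrow> Re (\<Sum>i<N. \<Sum>j<N. E y i j * \<rho> x j i) \<le> 1/3"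
    using smp_one_way[OF valid comp] unfolding N_def by blast
  define A where "A i = (\<lambda>a b. 2 * E (ys i) a b - of_bool (a = b))" for i
  define B where "B x = (\<lambda>a b. \<Sum>i<K. complex_of_real (x i) * A i a b)" for x :: "nat \<Rightarrow> real"
  have herm: "cnj (A i a b) = A i b a" if "i < K" "a < N" "b < N" for i a b
    using psd_cnj[OF E(1)[OF ys[OF that(1)]] that(2,3)] by (auto simp: A_def)
  have contr: "nrm N (app N (A i) v) \<le> nrm N v" if "i < K" for i v
    unfolding A_def by (rule effect_contraction[OF E(1,2)[OF ys[OF that]]])
  have large: "\<exists>w. 0 < nrm N w \<and> real K / 3 * (nrm N w)\<^sup>2 \<le> Re (cip N w (app N (B s) w))" if s: "s \<in> signs K" for s
  proof -
    define r where "r = \<rho> (xs s)"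
    have r: "psd N r" "(\<Sum>i<N. r i i) = 1" using \<rho> xs[OF s] by (auto simp: r_def)
    obtain W where W: "\<And>i j. i < N \<Longrightarrow> j < N \<Longrightarrow> r i j = (\<Sum>k<N. W k i * cnj (W k j))"
      using gram_decomposition[OF r(1)] by blast
    \<comment> \<open>The vectors \<open>W k\<close> are an ensemble of unnormalised pure states for
      \<open>r\<close>, with squared norms summing to 1. A bound on the trace against
      \<open>r\<close> is an average over them, so some \<open>W k\<close> must attain it.\<close>
    have gram: "(\<Sum>k<N. cip N (W k) (app N C (W k))) = (\<Sum>i<N. \<Sum>j<N. C i j * r j i)" for C
    proof -
      have "(\<Sum>k<N. cip N (W k) (app N C (W k))) = (\<Sum>i<N. \<Sum>k<N. \<Sum>j<N. cnj (W k i) * C i j * W k j)"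
        unfolding cip_app by (rule sum.swap)
      also have "\<dots> = (\<Sum>i<N. \<Sum>j<N. \<Sum>k<N. cnj (W k i) * C i j * W k j)"
        by (rule sum.cong[OF refl]) (rule sum.swap)
      also have "\<dots> = (\<Sum>i<N. \<Sum>j<N. C i j * r j i)"
        by (intro sum.cong refl) (simp add: W sum_distrib_left mult_ac)
      finally show ?thesis .
    qed
    have norms: "(\<Sum>k<N. (nrm N (W k))\<^sup>2) = 1"
    proof -
      have "(\<Sum>k<N. cip N (W k) (W k)) = (\<Sum>i<N. \<Sum>k<N. cnj (W k i) * W k i)"
        unfolding cip_def by (rule sum.swap)
      also have "\<dots> = (\<Sum>i<N. r i i)" by (intro sum.cong refl) (simp add: W mult.commute)
      finally show ?thesis unfolding r(2) cip_self by (metis of_real_eq_1_iff of_real_sum)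
    qed
    \<comment> \<open>Success probability 2/3 becomes an expected sign of at least
      \<open>2 * (2/3) - 1 = 1/3\<close>; this is the source of \<open>K / 3\<close>.\<close>
    have bias: "1 / 3 \<le> s i * Re (\<Sum>a<N. \<Sum>b<N. A i a b * r b a)" if i: "i < K" for i
    proof -
      define p where "p = Re (\<Sum>a<N. \<Sum>b<N. E (ys i) a b * r b a)"
      have p: "f (xs s) (ys i) \<Longrightarrow> 2 / 3 \<le> p" "\<not> f (xs s) (ys i) \<Longrightarrow> p \<le> 1 / 3"
        unfolding p_def r_def by (rule yes[OF xs[OF s] ys[OF i]] no[OF xs[OF s] ys[OF i]], assumption)+
      have "(\<Sum>a<N. \<Sum>b<N. A i a b * r b a)
        = (\<Sum>a<N. \<Sum>b<N. 2 * (E (ys i) a b * r b a) - (if b = a then r a a else 0))"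
        by (intro sum.cong refl) (auto simp: A_def left_diff_distrib)
      also have "\<dots> = 2 * (\<Sum>a<N. \<Sum>b<N. E (ys i) a b * r b a) - 1"
        using r(2) by (simp add: sum_subtractf sum_distrib_left)
      finally have "(\<Sum>a<N. \<Sum>b<N. A i a b * r b a) = 2 * (\<Sum>a<N. \<Sum>b<N. E (ys i) a b * r b a) - 1" .
      then have *: "Re (\<Sum>a<N. \<Sum>b<N. A i a b * r b a) = 2 * p - 1"
        by (simp add: p_def del: Re_sum)
      have "s i = 1 \<or> s i = -1" using s i by (auto simp: signs_def PiE_iff)
      then show ?thesis
        using p f[OF s i] unfolding * by (cases "s i = 1") auto
    qed
    have "(\<Sum>a<N. \<Sum>b<N. B s a b * r b a) = (\<Sum>i<K. of_real (s i) * (\<Sum>a<N. \<Sum>b<N. A i a b * r b a))"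
    proof -
      have "(\<Sum>a<N. \<Sum>b<N. B s a b * r b a) = (\<Sum>a<N. \<Sum>b<N. \<Sum>i<K. of_real (s i) * (A i a b * r b a))"
        by (simp add: B_def sum_distrib_right mult.assoc)
      also have "\<dots> = (\<Sum>a<N. \<Sum>i<K. \<Sum>b<N. of_real (s i) * (A i a b * r b a))"
        by (rule sum.cong[OF refl]) (rule sum.swap)
      also have "\<dots> = (\<Sum>i<K. \<Sum>a<N. \<Sum>b<N. of_real (s i) * (A i a b * r b a))"
        by (rule sum.swap)
      finally show ?thesis by (simp add: sum_distrib_left)
    qed
    then have "Re (\<Sum>a<N. \<Sum>b<N. B s a b * r b a) = (\<Sum>i<K. s i * Re (\<Sum>a<N. \<Sum>b<N. A i a b * r b a))"
      by (simp only: Re_sum[of _ "{..<K}"]) (simp del: Re_sum)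
    moreover have "(\<Sum>i<K. 1 / 3) \<le> (\<Sum>i<K. s i * Re (\<Sum>a<N. \<Sum>b<N. A i a b * r b a))"
      by (intro sum_mono bias) simp
    moreover have "(\<Sum>k<N. Re (cip N (W k) (app N (B s) (W k)))) = Re (\<Sum>a<N. \<Sum>b<N. B s a b * r b a)"
      using arg_cong[OF gram[of "B s"], of Re] by (simp only: Re_sum)
    ultimately have total: "real K / 3 \<le> (\<Sum>k<N. Re (cip N (W k) (app N (B s) (W k))))"
      by (simp del: Re_sum)
    show ?thesis
    proof (rule ccontr)
      assume neg: "\<not> ?thesis"
      have le: "Re (cip N (W k) (app N (B s) (W k))) \<le> real K / 3 * (nrm N (W k))\<^sup>2" for k
      proof (cases "nrm N (W k) = 0")
        case True
        then have "cmod (cip N (W k) (app N (B s) (W k))) \<le> 0" using cip_le[of N "W k"] by (metis mult_zero_left)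
        then show ?thesis using True by simp
      next
        case False
        then have "0 < nrm N (W k)" using nrm_nonneg[of N "W k"] by linarith
        then show ?thesis using neg by force
      qed
      have "\<not> (\<Sum>k<N. (nrm N (W k))\<^sup>2) \<le> 0" using norms by simp
      then obtain k where k: "k < N" "0 < (nrm N (W k))\<^sup>2"
        by (meson lessThan_iff not_less sum_nonpos)
      then have "0 < nrm N (W k)" using nrm_nonneg[of N "W k"] by (simp add: order_less_le)
      then have "Re (cip N (W k) (app N (B s) (W k))) < real K / 3 * (nrm N (W k))\<^sup>2" using neg by force
      with k(1) le have "(\<Sum>k<N. Re (cip N (W k) (app N (B s) (W k)))) < (\<Sum>k<N. real K / 3 * (nrm N (W k))\<^sup>2)"
        by (intro sum_strict_mono_ex1) auto
      also have "\<dots> = real K / 3" by (simp only: norms mult_1_right flip: sum_distrib_left)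
      finally show False using total by simp
    qed
  qed
  show ?thesis
    by (rule sign_sum_dimension_bound[OF herm contr large[unfolded B_def] N_def a])
qed

subsection \<open>Pure states and projective measurements\<close>

text \<open>The form is a sum of squared moduli, one for each \<open>r\<close>. A one-element
  \<open>R\<close> gives pure states, the rows of a symmetric idempotent give projections.\<close>

lemma real_gram_positive_semidef:
  fixes g :: "'r \<Rightarrow> nat \<Rightarrow> real"
  shows "positive_semidef n (mat n n (\<lambda>(p, q). complex_of_real (\<Sum>r\<in>R. g r p * g r q)))"
    (is "positive_semidef n ?A")
  unfolding positive_semidef_def
proof (intro conjI ballI)
  show A: "?A \<in> carrier_mat n n" by simp
  show "mat_adjoint ?A = ?A"
  proof (rule eq_matI)
    fix i j assume "i < dim_row ?A" "j < dim_col ?A"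
    then show "mat_adjoint ?A $$ (i, j) = ?A $$ (i, j)"
      by (subst mat_adjoint_index[OF A]) (auto simp: mult.commute)
  qed (auto simp: mat_adjoint_def)
  fix v :: "complex vec" assume v: "v \<in> carrier_vec n"
  have "(?A *\<^sub>v v) \<bullet>c v = (\<Sum>p<n. (\<Sum>q<n. (\<Sum>r\<in>R. of_real (g r p) * of_real (g r q)) * v $ q) * cnj (v $ p))"
    using v by (simp add: scalar_prod_def lessThan_atLeast0)
  also have "\<dots> = (\<Sum>p<n. \<Sum>q<n. \<Sum>r\<in>R. (of_real (g r q) * v $ q) * cnj (of_real (g r p) * v $ p))"
    by (simp add: sum_distrib_left sum_distrib_right mult_ac)
  also have "\<dots> = (\<Sum>p<n. \<Sum>r\<in>R. \<Sum>q<n. (of_real (g r q) * v $ q) * cnj (of_real (g r p) * v $ p))"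
    by (rule sum.cong[OF refl]) (rule sum.swap)
  also have "\<dots> = (\<Sum>r\<in>R. \<Sum>p<n. \<Sum>q<n. (of_real (g r q) * v $ q) * cnj (of_real (g r p) * v $ p))"
    by (rule sum.swap)
  also have "\<dots> = (\<Sum>r\<in>R. (\<Sum>q<n. of_real (g r q) * v $ q) * cnj (\<Sum>q<n. of_real (g r q) * v $ q))"
    unfolding cnj_sum sum_product by (rule sum.cong[OF refl]) (rule sum.swap)
  also have "\<dots> = of_real (\<Sum>r\<in>R. (cmod (\<Sum>q<n. of_real (g r q) * v $ q))\<^sup>2)"
    by (simp only: complex_norm_square[symmetric] of_real_sum)
  finally show "0 \<le> (?A *\<^sub>v v) \<bullet>c v"
    by (simp only: less_eq_complex_def) (simp add: sum_nonneg)
qed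

lemma pure_state_density:
  assumes "(\<Sum>i<N. (v i)\<^sup>2) = 1"
  shows "density_matrix N (mat N N (\<lambda>(i, j). complex_of_real (v i * v j)))"
proof -
  have "mat_trace (mat N N (\<lambda>(i, j). complex_of_real (v i * v j))) = of_real (\<Sum>i<N. (v i)\<^sup>2)"
    by (simp add: mat_trace_def power2_eq_square)
  then show ?thesis
    using real_gram_positive_semidef[of N "\<lambda>_::unit. v" UNIV] assms
    by (simp add: density_matrix_def)
qed

text \<open>A symmetric idempotent \<open>t\<close> is its own Gram matrix, and its complement is
  again a symmetric idempotent.\<close>

lemma projector_binary_POVM:
  fixes t :: "nat \<Rightarrow> nat \<Rightarrow> real"
  assumes sym: "\<And>p q. p < n \<Longrightarrow> q < n \<Longrightarrow> t p q = t q p"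
    and idem: "\<And>p q. p < n \<Longrightarrow> q < n \<Longrightarrow> (\<Sum>r<n. t p r * t r q) = t p q"
  shows "binary_POVM n (\<lambda>b. mat n n (\<lambda>(p, q). complex_of_real (if b then t p q else of_bool (p = q) - t p q)))"
proof -
  have psd: "positive_semidef n (mat n n (\<lambda>(p, q). complex_of_real (u p q)))"
    if "\<And>p q. p < n \<Longrightarrow> q < n \<Longrightarrow> u p q = u q p"
      and "\<And>p q. p < n \<Longrightarrow> q < n \<Longrightarrow> (\<Sum>r<n. u p r * u r q) = u p q" for u
  proof -
    have "mat n n (\<lambda>(p, q). complex_of_real (u p q)) = mat n n (\<lambda>(p, q). complex_of_real (\<Sum>r<n. u r p * u r q))"
    proof (rule eq_matI; clarsimp)
      fix p q assume pq: "p < n" "q < n"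
      have "u p q = (\<Sum>r<n. u r p * u r q)"
        unfolding that(2)[OF pq, symmetric] by (intro sum.cong refl) (use that(1) pq in auto)
      then show "complex_of_real (u p q) = (\<Sum>r<n. complex_of_real (u r p) * complex_of_real (u r q))" by simp
    qed
    then show ?thesis using real_gram_positive_semidef by simp
  qed
  have delta: "(\<Sum>r<n. of_bool (p = r) * f r) = f p" "(\<Sum>r<n. f r * of_bool (r = p)) = f p"
    if "p < n" for p and f :: "nat \<Rightarrow> real"
  proof -
    have "(\<Sum>r<n. of_bool (p = r) * f r) = (\<Sum>r<n. if r = p then f p else 0)"
      "(\<Sum>r<n. f r * of_bool (r = p)) = (\<Sum>r<n. if r = p then f p else 0)"
      by (auto intro!: sum.cong)
    then show "(\<Sum>r<n. of_bool (p = r) * f r) = f p" "(\<Sum>r<n. f r * of_bool (r = p)) = f p"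
      using that by simp_all
  qed
  have "(\<Sum>r<n. (of_bool (p = r) - t p r) * (of_bool (r = q) - t r q)) = of_bool (p = q) - t p q"
    if "p < n" "q < n" for p q
  proof -
    have "(\<Sum>r<n. (of_bool (p = r) - t p r) * (of_bool (r = q) - t r q))
      = (\<Sum>r<n. of_bool (p = r) * (of_bool (r = q) - t r q)) - (\<Sum>r<n. t p r * of_bool (r = q)) + (\<Sum>r<n. t p r * t r q)"
      by (simp add: left_diff_distrib right_diff_distrib sum_subtractf)
    then show ?thesis unfolding delta[OF that(1)] delta[OF that(2)] idem[OF that] by simp
  qed
  moreover have "of_bool (p = q) - t p q = of_bool (q = p) - t q p" if "p < n" "q < n" for p q
    using sym[OF that] by auto
  ultimately have "positive_semidef n (mat n n (\<lambda>(p, q). complex_of_real (of_bool (p = q) - t p q)))"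
    by (intro psd) auto
  moreover have "positive_semidef n (mat n n (\<lambda>(p, q). complex_of_real (t p q)))"
    using sym idem by (intro psd) auto
  moreover have "mat n n (\<lambda>(p, q). complex_of_real (of_bool (p = q) - t p q)) + mat n n (\<lambda>(p, q). complex_of_real (t p q)) = 1\<^sub>m n"
    by (rule eq_matI) auto
  ultimately show ?thesis
    unfolding binary_POVM_def by (simp only: if_True if_False all_bool_eq)
qed

text \<open>An orthogonal projection on real functions on \<open>I \<times> J\<close>, the accepting
  outcome of the referee. Arbitrary index sets let registers be products and power sets, without
  numbering their elements.\<close>

definition projective_test :: "'i set \<Rightarrow> 'j set \<Rightarrow> ('i \<times> 'j \<Rightarrow> 'i \<times> 'j \<Rightarrow> real) \<Rightarrow> bool" where
  "projective_test I J T \<longleftrightarrow> (\<forall>u\<in>I \<times> J. \<forall>v\<in>I \<times> J. T u v = T v u \<and> (\<Sum>w\<in>I \<times> J. T u w * T w v) = T u v)"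

definition acceptance :: "'i set \<Rightarrow> 'j set \<Rightarrow> ('i \<times> 'j \<Rightarrow> 'i \<times> 'j \<Rightarrow> real) \<Rightarrow> ('i \<Rightarrow> real) \<Rightarrow> ('j \<Rightarrow> real) \<Rightarrow> real" where
  "acceptance I J T \<psi> \<phi> = (\<Sum>i\<in>I. \<Sum>i'\<in>I. \<Sum>j\<in>J. \<Sum>j'\<in>J. T (i, j) (i', j') * (\<phi> j' * \<phi> j) * (\<psi> i' * \<psi> i))"

text \<open>Enumerating \<open>I\<close> and \<open>J\<close> carries the abstract test over to
  matrices. This is the only place where the registers of the protocol are numbered.\<close>

lemma smp_protocol_of_test:
  fixes I :: "'i set" and J :: "'j set"
  assumes I: "finite I" "card I = 2 ^ a" and J: "finite J" "card J = 2 ^ b"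
    and T: "projective_test I J T"
    and \<psi>: "\<And>x. x \<in> X \<Longrightarrow> (\<Sum>i\<in>I. (\<psi> x i)\<^sup>2) = 1" and \<phi>: "\<And>y. y \<in> Y \<Longrightarrow> (\<Sum>j\<in>J. (\<phi> y j)\<^sup>2) = 1"
    and yes: "\<And>x y. x \<in> X \<Longrightarrow> y \<in> Y \<Longrightarrow> f x y \<Longrightarrow> 2/3 \<le> acceptance I J T (\<psi> x) (\<phi> y)"
    and no: "\<And>x y. x \<in> X \<Longrightarrow> y \<in> Y \<Longrightarrow> \<not> f x y \<Longrightarrow> acceptance I J T (\<psi> x) (\<phi> y) \<le> 1/3"
  shows "\<exists>P. valid_protocol X Y P \<and> computes X Y P f \<and> protocol_cost P = a + b"
proof -
  define N :: nat where "N = 2 ^ a"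
  define B :: nat where "B = 2 ^ b"
  obtain gi where gi: "bij_betw gi {..<N} I"
    using ex_bij_betw_nat_finite[OF I(1)] I(2) by (auto simp: N_def lessThan_atLeast0)
  obtain gj where gj: "bij_betw gj {..<B} J"
    using ex_bij_betw_nat_finite[OF J(1)] J(2) by (auto simp: B_def lessThan_atLeast0)
  have sum_I: "(\<Sum>i<N. h (gi i)) = (\<Sum>i\<in>I. h i)" for h :: "'i \<Rightarrow> real"
    by (rule sum.reindex_bij_betw[OF gi])
  have sum_J: "(\<Sum>j<B. h (gj j)) = (\<Sum>j\<in>J. h j)" for h :: "'j \<Rightarrow> real"
    by (rule sum.reindex_bij_betw[OF gj])
  have T_sym: "T u v = T v u" and T_idem: "(\<Sum>w\<in>I \<times> J. T u w * T w v) = T u v"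
    if "u \<in> I \<times> J" "v \<in> I \<times> J" for u v
    using T[unfolded projective_test_def, rule_format, OF that] by (rule conjunct1, rule conjunct2)
  have Bpos: "0 < B" by (simp add: B_def)
  define pos where "pos p = (gi (p div B), gj (p mod B))" for p
  have pos_in: "pos p \<in> I \<times> J" if "p < N * B" for p
  proof -
    have "p div B < N" using that by (simp add: less_mult_imp_div_less)
    then show ?thesis using gi gj Bpos by (auto simp: pos_def bij_betw_def)
  qed
  have pos_pair: "pos (i * B + j) = (gi i, gj j)" if "j < B" for i j
    using that by (simp add: pos_def)
  define t where "t p q = T (pos p) (pos q)" for p q
  define M where "M = (\<lambda>b. mat (N * B) (N * B) (\<lambda>(p, q). complex_of_real (if b then t p q else of_bool (p = q) - t p q)))"
  define P where "P = \<lparr>alice_qubits = a, bob_qubits = b,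
     alice_state = (\<lambda>x. mat N N (\<lambda>(i, j). complex_of_real (\<psi> x (gi i) * \<psi> x (gi j)))),
     bob_state = (\<lambda>y. mat B B (\<lambda>(i, j). complex_of_real (\<phi> y (gj i) * \<phi> y (gj j)))),
     referee = M\<rparr>"
  have povm: "binary_POVM (N * B) M"
    unfolding M_def
  proof (rule projector_binary_POVM)
    fix p q assume pq: "p < N * B" "q < N * B"
    show "t p q = t q p"
      unfolding t_def by (rule T_sym[OF pos_in[OF pq(1)] pos_in[OF pq(2)]])
    have "(\<Sum>r<N * B. t p r * t r q) = (\<Sum>i<N. \<Sum>j<B. T (pos p) (gi i, gj j) * T (gi i, gj j) (pos q))"
      unfolding sum_lessThan_mult t_def by (intro sum.cong refl) (simp add: pos_pair)
    also have "\<dots> = (\<Sum>i\<in>I. \<Sum>j\<in>J. T (pos p) (i, j) * T (i, j) (pos q))"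
      unfolding sum_I[symmetric] sum_J[symmetric] ..
    also have "\<dots> = (\<Sum>w\<in>I \<times> J. T (pos p) w * T w (pos q))"
      unfolding sum.cartesian_product by (intro sum.cong) auto
    also have "\<dots> = t p q"
      unfolding t_def by (rule T_idem[OF pos_in[OF pq(1)] pos_in[OF pq(2)]])
    finally show "(\<Sum>r<N * B. t p r * t r q) = t p q" .
  qed
  have "valid_protocol X Y P"
    unfolding valid_protocol_def
  proof (intro conjI ballI)
    fix x assume "x \<in> X"
    then show "density_matrix (2 ^ alice_qubits P) (alice_state P x)"
      using pure_state_density[of "\<lambda>i. \<psi> x (gi i)" N] sum_I[of "\<lambda>i. (\<psi> x i)\<^sup>2"] \<psi>
      by (simp add: P_def N_def[symmetric])
  next
    fix y assume "y \<in> Y"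
    then show "density_matrix (2 ^ bob_qubits P) (bob_state P y)"
      using pure_state_density[of "\<lambda>i. \<phi> y (gj i)" B] sum_J[of "\<lambda>i. (\<phi> y i)\<^sup>2"] \<phi>
      by (simp add: P_def B_def[symmetric])
  next
    show "binary_POVM (2 ^ (alice_qubits P + bob_qubits P)) (referee P)"
      using povm by (simp add: P_def N_def B_def power_add)
  qed
  moreover have "computes X Y P f"
    unfolding computes_def
  proof (intro ballI)
    fix x y assume x: "x \<in> X" and y: "y \<in> Y"
    let ?\<rho> = "alice_state P x" and ?\<sigma> = "bob_state P y"
    have c: "?\<rho> \<in> carrier_mat N N" "?\<sigma> \<in> carrier_mat B B" by (simp_all add: P_def)
    have cM: "M b \<in> carrier_mat (N * B) (N * B)" for b by (simp add: M_def)
    have ent: "?\<rho> $$ (i, j) = of_real (\<psi> x (gi i) * \<psi> x (gi j))" if "i < N" "j < N" for i j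
      using that by (simp add: P_def)
    have ent': "?\<sigma> $$ (i, j) = of_real (\<phi> y (gj i) * \<phi> y (gj j))" if "i < B" "j < B" for i j
      using that by (simp add: P_def)
    have tr: "mat_trace (M b * tensor_mat ?\<rho> ?\<sigma>) = of_real (\<Sum>i<N. \<Sum>i'<N. \<Sum>j<B. \<Sum>j'<B.
        (if b then t (i * B + j) (i' * B + j') else of_bool (i * B + j = i' * B + j') - t (i * B + j) (i' * B + j'))
          * (\<phi> y (gj j') * \<phi> y (gj j)) * (\<psi> x (gi i') * \<psi> x (gi i)))" for b
      unfolding trace_tensor[OF cM c] slice_def of_real_sum sum_distrib_right
      by (intro sum.cong refl) (simp add: ent ent' M_def pair_index_less)
    have "mat_trace (M True * tensor_mat ?\<rho> ?\<sigma>) = of_real (\<Sum>i<N. \<Sum>i'<N. \<Sum>j<B. \<Sum>j'<B.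
        T (gi i, gj j) (gi i', gj j') * (\<phi> y (gj j') * \<phi> y (gj j)) * (\<psi> x (gi i') * \<psi> x (gi i)))"
      unfolding tr of_real_eq_iff by (intro sum.cong refl) (simp add: t_def pos_pair)
    also have "\<dots> = of_real (acceptance I J T (\<psi> x) (\<phi> y))"
      unfolding acceptance_def sum_I[symmetric] sum_J[symmetric] ..
    finally have T': "outcome_prob M (tensor_mat ?\<rho> ?\<sigma>) True = acceptance I J T (\<psi> x) (\<phi> y)"
      by (simp add: outcome_prob_def)
    \<comment> \<open>The two outcomes add up to the squared norm of the product state, so rejection
      has the complementary probability.\<close>
    have "mat_trace (M False * tensor_mat ?\<rho> ?\<sigma>) + mat_trace (M True * tensor_mat ?\<rho> ?\<sigma>)
      = of_real (\<Sum>i<N. \<Sum>i'<N. \<Sum>j<B. \<Sum>j'<B.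
         of_bool (i * B + j = i' * B + j') * (\<phi> y (gj j') * \<phi> y (gj j)) * (\<psi> x (gi i') * \<psi> x (gi i)))"
      unfolding tr of_real_add[symmetric] sum.distrib[symmetric] of_real_eq_iff
      by (intro sum.cong refl) (simp add: left_diff_distrib)
    also have "\<dots> = of_real (\<Sum>i<N. \<Sum>i'<N. (of_bool (i = i') * (\<Sum>j<B. (\<phi> y (gj j))\<^sup>2)) * (\<psi> x (gi i') * \<psi> x (gi i)))"
    proof -
      have "(\<Sum>j<B. \<Sum>j'<B. of_bool (i * B + j = i' * B + j') * (\<phi> y (gj j') * \<phi> y (gj j)) * (\<psi> x (gi i') * \<psi> x (gi i)))
        = (of_bool (i = i') * (\<Sum>j<B. (\<phi> y (gj j))\<^sup>2)) * (\<psi> x (gi i') * \<psi> x (gi i))" for i i'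
      proof -
        have "(\<Sum>j<B. \<Sum>j'<B. of_bool (i * B + j = i' * B + j') * (\<phi> y (gj j') * \<phi> y (gj j)) * (\<psi> x (gi i') * \<psi> x (gi i)))
          = (\<Sum>j<B. \<Sum>j'<B. if j' = j then of_bool (i = i') * (\<phi> y (gj j))\<^sup>2 * (\<psi> x (gi i') * \<psi> x (gi i)) else 0)"
          by (intro sum.cong refl) (auto simp: pair_index_eq_iff power2_eq_square)
        also have "\<dots> = (\<Sum>j<B. of_bool (i = i') * (\<phi> y (gj j))\<^sup>2 * (\<psi> x (gi i') * \<psi> x (gi i)))"
          by (intro sum.cong refl) simp
        finally show ?thesis unfolding sum_distrib_left sum_distrib_right .
      qed
      then show ?thesis by (simp only:)
    qed
    also have "(\<Sum>j<B. (\<phi> y (gj j))\<^sup>2) = 1" using sum_J[of "\<lambda>j. (\<phi> y j)\<^sup>2"] \<phi>[OF y] by simp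
    also have "(\<Sum>i<N. \<Sum>i'<N. (of_bool (i = i') * 1) * (\<psi> x (gi i') * \<psi> x (gi i)))
        = (\<Sum>i<N. \<Sum>i'<N. if i' = i then (\<psi> x (gi i))\<^sup>2 else 0)"
      by (intro sum.cong refl) (auto simp: power2_eq_square)
    also have "\<dots> = 1" using sum_I[of "\<lambda>i. (\<psi> x i)\<^sup>2"] \<psi>[OF x] by simp
    finally have F': "outcome_prob M (tensor_mat ?\<rho> ?\<sigma>) False = 1 - acceptance I J T (\<psi> x) (\<phi> y)"
      using T' by (simp add: outcome_prob_def complex_eq_iff)
    have "referee P = M" by (simp add: P_def)
    then show "2 / 3 \<le> outcome_prob (referee P) (tensor_mat ?\<rho> ?\<sigma>) (f x y)"
      using yes[OF x y] no[OF x y] T' F' by (cases "f x y") auto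
  qed
  moreover have "protocol_cost P = a + b" by (simp add: P_def protocol_cost_def)
  ultimately show ?thesis by blast
qed

text \<open>Two independent runs, accepting if both accept. \<open>T2\<close> is the tensor square
  of \<open>T\<close> with its factors regrouped so that the two parts held by each player are
  adjacent. Certain acceptance stays certain, smaller probabilities are squared.\<close>

lemma square_test:
  fixes T :: "'i \<times> 'j \<Rightarrow> 'i \<times> 'j \<Rightarrow> real"
  assumes "projective_test I J T"
  defines "T2 \<equiv> \<lambda>((i1, i2), (j1, j2)) ((i1', i2'), (j1', j2')). T (i1, j1) (i1', j1') * T (i2, j2) (i2', j2')"
  shows "projective_test (I \<times> I) (J \<times> J) T2"
    and "acceptance (I \<times> I) (J \<times> J) T2 (\<lambda>(i1, i2). \<psi> i1 * \<psi> i2) (\<lambda>(j1, j2). \<phi> j1 * \<phi> j2) = (acceptance I J T \<psi> \<phi>)\<^sup>2"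
proof -
  have sym: "T (i, j) (i', j') = T (i', j') (i, j)" if "i \<in> I" "j \<in> J" "i' \<in> I" "j' \<in> J" for i j i' j'
    using assms(1) that unfolding projective_test_def by blast
  have idem: "(\<Sum>a\<in>I. \<Sum>b\<in>J. T (i, j) (a, b) * T (a, b) (i', j')) = T (i, j) (i', j')"
    if "i \<in> I" "j \<in> J" "i' \<in> I" "j' \<in> J" for i j i' j'
  proof -
    have "(\<Sum>w\<in>I \<times> J. T (i, j) w * T w (i', j')) = T (i, j) (i', j')"
      using assms(1) that unfolding projective_test_def by blast
    then show ?thesis unfolding sum.cartesian_product by (simp add: case_prod_unfold)
  qed
  show "projective_test (I \<times> I) (J \<times> J) T2"
    unfolding projective_test_def
  proof (intro ballI conjI)
    fix u v assume "u \<in> (I \<times> I) \<times> (J \<times> J)" "v \<in> (I \<times> I) \<times> (J \<times> J)"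
    then obtain i1 i2 j1 j2 i1' i2' j1' j2' where
      [simp]: "u = ((i1, i2), (j1, j2))" "v = ((i1', i2'), (j1', j2'))" and
      m: "i1 \<in> I" "i2 \<in> I" "j1 \<in> J" "j2 \<in> J" "i1' \<in> I" "i2' \<in> I" "j1' \<in> J" "j2' \<in> J" by auto
    show "T2 u v = T2 v u"
      using sym[OF m(1,3,5,7)] sym[OF m(2,4,6,8)] by (simp add: T2_def)
    have "(\<Sum>w\<in>(I \<times> I) \<times> (J \<times> J). T2 u w * T2 w v)
      = (\<Sum>a1\<in>I. \<Sum>a2\<in>I. \<Sum>b1\<in>J. \<Sum>b2\<in>J. (T (i1, j1) (a1, b1) * T (a1, b1) (i1', j1')) * (T (i2, j2) (a2, b2) * T (a2, b2) (i2', j2')))"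
      unfolding sum.cartesian_product' by (intro sum.cong refl) (simp add: T2_def)
    also have "\<dots> = (\<Sum>a1\<in>I. \<Sum>a2\<in>I. (\<Sum>b1\<in>J. T (i1, j1) (a1, b1) * T (a1, b1) (i1', j1')) * (\<Sum>b2\<in>J. T (i2, j2) (a2, b2) * T (a2, b2) (i2', j2')))"
      unfolding sum_product ..
    also have "\<dots> = (\<Sum>a1\<in>I. \<Sum>b1\<in>J. T (i1, j1) (a1, b1) * T (a1, b1) (i1', j1')) * (\<Sum>a2\<in>I. \<Sum>b2\<in>J. T (i2, j2) (a2, b2) * T (a2, b2) (i2', j2'))"
      unfolding sum_product ..
    also have "\<dots> = T2 u v"
      unfolding idem[OF m(1,3,5,7)] idem[OF m(2,4,6,8)] by (simp add: T2_def)
    finally show "(\<Sum>w\<in>(I \<times> I) \<times> (J \<times> J). T2 u w * T2 w v) = T2 u v" .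
  qed
  let ?t = "\<lambda>i i' j j'. T (i, j) (i', j') * (\<phi> j' * \<phi> j) * (\<psi> i' * \<psi> i)"
  have "acceptance (I \<times> I) (J \<times> J) T2 (\<lambda>(i1, i2). \<psi> i1 * \<psi> i2) (\<lambda>(j1, j2). \<phi> j1 * \<phi> j2)
     = (\<Sum>i1\<in>I. \<Sum>i2\<in>I. \<Sum>i1'\<in>I. \<Sum>i2'\<in>I. \<Sum>j1\<in>J. \<Sum>j2\<in>J. \<Sum>j1'\<in>J. \<Sum>j2'\<in>J. ?t i1 i1' j1 j1' * ?t i2 i2' j2 j2')"
    unfolding acceptance_def sum.cartesian_product' T2_def by (simp add: mult_ac)
  also have "\<dots> = (\<Sum>i1\<in>I. \<Sum>i1'\<in>I. \<Sum>j1\<in>J. \<Sum>j1'\<in>J. ?t i1 i1' j1 j1') * (\<Sum>i2\<in>I. \<Sum>i2'\<in>I. \<Sum>j2\<in>J. \<Sum>j2'\<in>J. ?t i2 i2' j2 j2')"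
    unfolding sum_product ..
  also have "\<dots> = (acceptance I J T \<psi> \<phi>)\<^sup>2"
    by (simp only: acceptance_def power2_eq_square)
  finally show "acceptance (I \<times> I) (J \<times> J) T2 (\<lambda>(i1, i2). \<psi> i1 * \<psi> i2) (\<lambda>(j1, j2). \<phi> j1 * \<phi> j2) = (acceptance I J T \<psi> \<phi>)\<^sup>2" .
qed

section \<open>Swap tests controlled by classical registers\<close>

text \<open>The swap-test projection \<open>(1 + F) / 2\<close>, where the swap \<open>F\<close> is
  conjugated by the diagonal matrix of the signs \<open>\<chi>\<close> on one of the two
  registers.\<close>

definition swap_kernel :: "('r \<Rightarrow> real) \<Rightarrow> 'r \<Rightarrow> 'r \<Rightarrow> 'r \<Rightarrow> 'r \<Rightarrow> real" where
  "swap_kernel \<chi> j k i l = (of_bool (j = i \<and> k = l) + \<chi> j * \<chi> k * of_bool (j = l \<and> k = i)) / 2"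

lemma sum_sum_delta:
  fixes F :: "'r \<Rightarrow> 'r \<Rightarrow> real"
  assumes "finite R" "i \<in> R" "j \<in> R"
  shows "(\<Sum>a\<in>R. \<Sum>b\<in>R. of_bool (i = a \<and> j = b) * F a b) = F i j"
proof -
  have "(\<Sum>a\<in>R. \<Sum>b\<in>R. of_bool (i = a \<and> j = b) * F a b) = (\<Sum>a\<in>R. if a = i then (\<Sum>b\<in>R. if b = j then F i j else 0) else 0)"
    by (intro sum.cong) (auto intro!: sum.cong sum.neutral)
  then show ?thesis using assms by simp
qed

lemma swap_kernel_sym: "swap_kernel \<chi> j k i l = swap_kernel \<chi> i l j k"
proof -
  have "\<chi> j * \<chi> k * of_bool (j = l \<and> k = i) = \<chi> i * \<chi> l * of_bool (i = k \<and> l = j)"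
    by (cases "j = l \<and> k = i") auto
  moreover have "(j = i \<and> k = l) = (i = j \<and> l = k)" by blast
  ultimately show ?thesis unfolding swap_kernel_def by (simp only:)
qed

text \<open>The signed swap is an involution because \<open>\<chi> r * \<chi> r = 1\<close>, and
  half of identity plus involution is idempotent.\<close>

lemma swap_kernel_idem:
  assumes R: "finite R" "j \<in> R" "k \<in> R" and \<chi>: "\<And>r. r \<in> R \<Longrightarrow> \<chi> r * \<chi> r = (1 :: real)"
  shows "(\<Sum>a\<in>R. \<Sum>b\<in>R. swap_kernel \<chi> j k a b * swap_kernel \<chi> a b i l) = swap_kernel \<chi> j k i l"
proof -
  have "(\<Sum>a\<in>R. \<Sum>b\<in>R. swap_kernel \<chi> j k a b * swap_kernel \<chi> a b i l)
    = ((\<Sum>a\<in>R. \<Sum>b\<in>R. of_bool (j = a \<and> k = b) * swap_kernel \<chi> a b i l)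
       + \<chi> j * \<chi> k * (\<Sum>a\<in>R. \<Sum>b\<in>R. of_bool (k = a \<and> j = b) * swap_kernel \<chi> a b i l)) / 2"
    unfolding sum_distrib_left sum.distrib[symmetric] sum_divide_distrib
    by (intro sum.cong refl) (auto simp: swap_kernel_def[of \<chi> j k] field_simps)
  also have "\<dots> = (swap_kernel \<chi> j k i l + \<chi> j * \<chi> k * swap_kernel \<chi> k j i l) / 2"
    unfolding sum_sum_delta[OF R] sum_sum_delta[OF R(1,3,2)] ..
  also have "\<chi> j * \<chi> k * swap_kernel \<chi> k j i l = swap_kernel \<chi> j k i l"
  proof -
    have "\<chi> j * \<chi> k * (\<chi> k * \<chi> j) = (\<chi> j * \<chi> j) * (\<chi> k * \<chi> k)" by simp
    then have "\<chi> j * \<chi> k * (\<chi> k * \<chi> j) = 1" using \<chi> R by simp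
    moreover have "c * ((p + c' * q) / 2) = (c * c' * q + c * p) / 2" for c c' p q :: real
      by (simp add: distrib_left mult.assoc add.commute)
    moreover have "(k = i \<and> j = l) = (j = l \<and> k = i)" "(k = l \<and> j = i) = (j = i \<and> k = l)" by auto
    ultimately show ?thesis unfolding swap_kernel_def by (simp only: mult_1_left)
  qed
  finally show ?thesis by simp
qed

lemma swap_kernel_value:
  assumes R: "finite R"
  shows "(\<Sum>j\<in>R. \<Sum>i\<in>R. \<Sum>k\<in>R. \<Sum>l\<in>R. swap_kernel \<chi> j k i l * (h' l * h' k) * (h i * h j))
    = ((\<Sum>j\<in>R. (h j)\<^sup>2) * (\<Sum>k\<in>R. (h' k)\<^sup>2) + (\<Sum>j\<in>R. \<chi> j * h j * h' j)\<^sup>2) / 2"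
proof -
  have "(\<Sum>j\<in>R. \<Sum>i\<in>R. \<Sum>k\<in>R. \<Sum>l\<in>R. swap_kernel \<chi> j k i l * (h' l * h' k) * (h i * h j))
    = (\<Sum>j\<in>R. \<Sum>k\<in>R. \<Sum>i\<in>R. \<Sum>l\<in>R. swap_kernel \<chi> j k i l * (h' l * h' k) * (h i * h j))"
    by (rule sum.cong[OF refl]) (rule sum.swap)
  also have "\<dots> = (\<Sum>j\<in>R. \<Sum>k\<in>R. ((h j)\<^sup>2 * (h' k)\<^sup>2 + (\<chi> j * h j * h' j) * (\<chi> k * h k * h' k)) / 2)"
  proof (intro sum.cong refl)
    fix j k assume jk: "j \<in> R" "k \<in> R"
    have "(\<Sum>i\<in>R. \<Sum>l\<in>R. swap_kernel \<chi> j k i l * (h' l * h' k) * (h i * h j))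
      = ((\<Sum>i\<in>R. \<Sum>l\<in>R. of_bool (j = i \<and> k = l) * (h' l * h' k * (h i * h j)))
        + (\<Sum>i\<in>R. \<Sum>l\<in>R. of_bool (k = i \<and> j = l) * (\<chi> j * \<chi> k * (h' l * h' k) * (h i * h j)))) / 2"
      unfolding sum.distrib[symmetric] sum_divide_distrib
      by (intro sum.cong refl) (auto simp: swap_kernel_def field_simps)
    also have "\<dots> = ((h j)\<^sup>2 * (h' k)\<^sup>2 + (\<chi> j * h j * h' j) * (\<chi> k * h k * h' k)) / 2"
      unfolding sum_sum_delta[OF R jk] sum_sum_delta[OF R jk(2,1)] by (simp add: power2_eq_square mult_ac)
    finally show "(\<Sum>i\<in>R. \<Sum>l\<in>R. swap_kernel \<chi> j k i l * (h' l * h' k) * (h i * h j))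
      = ((h j)\<^sup>2 * (h' k)\<^sup>2 + (\<chi> j * h j * h' j) * (\<chi> k * h k * h' k)) / 2" .
  qed
  also have "\<dots> = ((\<Sum>j\<in>R. (h j)\<^sup>2) * (\<Sum>k\<in>R. (h' k)\<^sup>2) + (\<Sum>j\<in>R. \<chi> j * h j * h' j)\<^sup>2) / 2"
    by (simp only: sum_product power2_eq_square[of "sum _ _"] sum.distrib sum_divide_distrib[symmetric])
  finally show ?thesis .
qed

text \<open>The classical registers \<open>s\<close>, \<open>s'\<close> select whether the referee rejects outright (\<open>g s s' = False\<close>) or performs
  the swap test in which one of the two fingerprints is multiplied by the signs \<open>\<chi> s s'\<close>.\<close>

definition controlled_swap ::
  "('s \<Rightarrow> 's \<Rightarrow> bool) \<Rightarrow> ('s \<Rightarrow> 's \<Rightarrow> 'r \<Rightarrow> real) \<Rightarrow> ('s \<times> 'r) \<times> ('s \<times> 'r) \<Rightarrow> ('s \<times> 'r) \<times> ('s \<times> 'r) \<Rightarrow> real" where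
  "controlled_swap g \<chi> = (\<lambda>((s, j), (s', k)) ((t, i), (t', l)).
     of_bool (s = t \<and> s' = t') * (of_bool (g s s') * swap_kernel (\<chi> s s') j k i l))"

lemma sum_pick:
  fixes F :: "'s \<times> 'r \<Rightarrow> real"
  assumes "finite S" "s \<in> S"
  shows "(\<Sum>p\<in>S \<times> R. F p * (of_bool (fst p = s) * h (snd p))) = (\<Sum>j\<in>R. F (s, j) * h j)"
proof -
  have "(\<Sum>p\<in>S \<times> R. F p * (of_bool (fst p = s) * h (snd p))) = (\<Sum>t\<in>S. \<Sum>j\<in>R. F (t, j) * (of_bool (t = s) * h j))"
    unfolding sum.cartesian_product by (intro sum.cong) auto
  also have "\<dots> = (\<Sum>t\<in>S. if t = s then (\<Sum>j\<in>R. F (s, j) * h j) else 0)"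
    by (intro sum.cong) auto
  finally show ?thesis using assms by simp
qed

text \<open>The kernel is block diagonal in \<open>(s, s')\<close>, and each block is zero or a
  signed swap projection.\<close>

lemma controlled_swap_test:
  assumes S: "finite S" and R: "finite R" and \<chi>: "\<And>s s' r. r \<in> R \<Longrightarrow> \<chi> s s' r * \<chi> s s' r = 1"
  shows "projective_test (S \<times> R) (S \<times> R) (controlled_swap g \<chi>)"
  unfolding projective_test_def
proof (intro ballI conjI)
  fix u v assume "u \<in> (S \<times> R) \<times> (S \<times> R)" "v \<in> (S \<times> R) \<times> (S \<times> R)"
  then obtain s j s' k t i t' l where
    [simp]: "u = ((s, j), (s', k))" "v = ((t, i), (t', l))" and
    m: "s \<in> S" "j \<in> R" "s' \<in> S" "k \<in> R" "t \<in> S" "i \<in> R" "t' \<in> S" "l \<in> R" by auto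
  show "controlled_swap g \<chi> u v = controlled_swap g \<chi> v u"
  proof (cases "s = t \<and> s' = t'")
    case True
    then show ?thesis
      using swap_kernel_sym[of "\<chi> s s'" j k i l] by (simp add: controlled_swap_def)
  next
    case False
    then show ?thesis by (simp add: controlled_swap_def) blast
  qed
  have row: "controlled_swap g \<chi> u (p, q)
    = of_bool (g s s') * swap_kernel (\<chi> s s') j k (snd p) (snd q) * of_bool (fst q = s') * of_bool (fst p = s)" for p q
    by (cases p; cases q) (auto simp: controlled_swap_def)
  have "(\<Sum>w\<in>(S \<times> R) \<times> (S \<times> R). controlled_swap g \<chi> u w * controlled_swap g \<chi> w v)
    = (\<Sum>p\<in>S \<times> R. \<Sum>q\<in>S \<times> R. controlled_swap g \<chi> u (p, q) * controlled_swap g \<chi> (p, q) v)"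
    unfolding sum.cartesian_product by (intro sum.cong) auto
  also have "\<dots> = (\<Sum>p\<in>S \<times> R. (\<Sum>q\<in>S \<times> R. (of_bool (g s s') * swap_kernel (\<chi> s s') j k (snd p) (snd q) * controlled_swap g \<chi> (p, q) v)
       * (of_bool (fst q = s') * 1)) * (of_bool (fst p = s) * 1))"
    unfolding sum_distrib_right row by (intro sum.cong refl) (simp only: mult_ac mult_1_left)
  also have "\<dots> = (\<Sum>a\<in>R. \<Sum>b\<in>R. of_bool (g s s') * swap_kernel (\<chi> s s') j k a b * controlled_swap g \<chi> ((s, a), (s', b)) v)"
    unfolding sum_pick[OF S m(1), where h = "\<lambda>_. 1" and R = R] sum_pick[OF S m(3), where h = "\<lambda>_. 1" and R = R]
    by (simp only: mult_1_right fst_conv snd_conv)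
  also have "\<dots> = of_bool (s = t \<and> s' = t') * of_bool (g s s') * (\<Sum>a\<in>R. \<Sum>b\<in>R. swap_kernel (\<chi> s s') j k a b * swap_kernel (\<chi> s s') a b i l)"
    unfolding sum_distrib_left by (intro sum.cong refl) (auto simp: controlled_swap_def)
  also have "\<dots> = controlled_swap g \<chi> u v"
    by (subst swap_kernel_idem[OF R m(2,4)]) (simp_all add: \<chi> controlled_swap_def)
  finally show "(\<Sum>w\<in>(S \<times> R) \<times> (S \<times> R). controlled_swap g \<chi> u w * controlled_swap g \<chi> w v) = controlled_swap g \<chi> u v" .
qed

text \<open>The classical registers are basis states, so only the block \<open>(s, s')\<close>
  contributes, and there the value is that of the swap test.\<close>

lemma controlled_swap_acceptance:
  assumes S: "finite S" "s \<in> S" "s' \<in> S" and R: "finite R"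
    and h: "(\<Sum>j\<in>R. (h j)\<^sup>2) = 1" "(\<Sum>j\<in>R. (h' j)\<^sup>2) = 1"
  shows "acceptance (S \<times> R) (S \<times> R) (controlled_swap g \<chi>) (\<lambda>p. of_bool (fst p = s) * h (snd p)) (\<lambda>p. of_bool (fst p = s') * h' (snd p))
    = of_bool (g s s') * ((1 + (\<Sum>j\<in>R. \<chi> s s' j * h j * h' j)\<^sup>2) / 2)"
proof -
  let ?T = "controlled_swap g \<chi>"
  let ?\<psi> = "\<lambda>p. of_bool (fst p = s) * h (snd p)" and ?\<phi> = "\<lambda>p. of_bool (fst p = s') * h' (snd p)"
  note p = sum_pick[OF S(1,2), where h = h and R = R] and p' = sum_pick[OF S(1,3), where h = h' and R = R]
  have "acceptance (S \<times> R) (S \<times> R) ?T ?\<psi> ?\<phi>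
    = (\<Sum>i\<in>S \<times> R. (\<Sum>i'\<in>S \<times> R. (\<Sum>j\<in>S \<times> R. (\<Sum>j'\<in>S \<times> R. ?T (i, j) (i', j') * ?\<phi> j') * ?\<phi> j) * ?\<psi> i') * ?\<psi> i)"
    unfolding acceptance_def sum_distrib_right by (intro sum.cong refl) (simp only: mult_ac)
  also have "\<dots> = (\<Sum>i\<in>R. (\<Sum>i'\<in>R. (\<Sum>j\<in>R. (\<Sum>j'\<in>R. ?T ((s, i), (s', j)) ((s, i'), (s', j')) * h' j') * h' j) * h i') * h i)"
    unfolding p p' ..
  also have "\<dots> = (\<Sum>i\<in>R. \<Sum>i'\<in>R. \<Sum>j\<in>R. \<Sum>j'\<in>R. of_bool (g s s') * (swap_kernel (\<chi> s s') i j i' j' * (h' j' * h' j) * (h i' * h i)))"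
    unfolding sum_distrib_right by (intro sum.cong refl) (simp add: controlled_swap_def mult_ac)
  also have "\<dots> = of_bool (g s s') * ((1 + (\<Sum>j\<in>R. \<chi> s s' j * h j * h' j)\<^sup>2) / 2)"
    unfolding sum_distrib_left[symmetric] swap_kernel_value[OF R] h by simp
  finally show ?thesis .
qed

lemma controlled_swap_state:
  assumes "finite S" "s \<in> S" "(\<Sum>j\<in>R. (h j)\<^sup>2) = (1 :: real)"
  shows "(\<Sum>p\<in>S \<times> R. (of_bool (fst p = s) * h (snd p))\<^sup>2) = 1"
proof -
  have "(\<Sum>p\<in>S \<times> R. (of_bool (fst p = s) * h (snd p))\<^sup>2)
    = (\<Sum>p\<in>S \<times> R. h (snd p) * (of_bool (fst p = s) * h (snd p)))"
    by (intro sum.cong refl) (auto simp: power2_eq_square)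
  also have "\<dots> = (\<Sum>j\<in>R. h j * h j)"
    using sum_pick[OF assms(1,2), of "\<lambda>p. h (snd p)" h R] by simp
  finally show ?thesis using assms(3) by (simp add: power2_eq_square)
qed

subsection \<open>Characters and random linear codes\<close>

text \<open>For finite \<open>r\<close> this is -1 to the power of the size of
  \<open>A \<inter> r\<close>: a character of the group of sets under \<open>sym_diff\<close>. The
  set \<open>A\<close> plays the input, \<open>r\<close> a parity check.\<close>

definition char_sign :: "'a set \<Rightarrow> 'a set \<Rightarrow> real" where
  "char_sign A r = (\<Prod>i\<in>r. if i \<in> A then -1 else 1)"

lemma char_sign_cases: "char_sign A r = 1 \<or> char_sign A r = -1"
  unfolding char_sign_def by (induction r rule: infinite_finite_induct) auto

lemma char_sign_square: "char_sign A r * char_sign A r = 1"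
  using char_sign_cases[of A r] by auto

lemma char_sign_sym_diff: "char_sign (sym_diff A B) r = char_sign A r * char_sign B r"
  unfolding char_sign_def prod.distrib[symmetric] by (intro prod.cong) auto

lemma sum_char_sign:
  assumes "finite U" "A \<subseteq> U" "A \<noteq> {}"
  shows "(\<Sum>r\<in>Pow U. char_sign A r) = 0"
proof -
  have "(\<Sum>r\<in>Pow U. char_sign A r) = (\<Prod>i\<in>U. (if i \<in> A then -1 else 1) + 1)"
    unfolding char_sign_def by (subst prod_add[OF assms(1)]) simp
  also have "\<dots> = 0" using assms by (subst prod_zero_iff) auto
  finally show ?thesis .
qed

text \<open>On the values 1 and -1 every function is affine, so the vanishing character sum already
  makes the sign uniformly distributed.\<close>

lemma sum_fun_char_sign:
  fixes G :: "real \<Rightarrow> real"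
  assumes "finite U" "A \<subseteq> U" "A \<noteq> {}"
  shows "(\<Sum>r\<in>Pow U. G (char_sign A r)) = 2 ^ card U * ((G 1 + G (-1)) / 2)"
proof -
  have "G (char_sign A r) = (G 1 + G (-1)) / 2 + char_sign A r * ((G 1 - G (-1)) / 2)" for r
    using char_sign_cases[of A r] by (auto simp: field_simps)
  then have "(\<Sum>r\<in>Pow U. G (char_sign A r))
    = (\<Sum>r\<in>Pow U. (G 1 + G (-1)) / 2) + (\<Sum>r\<in>Pow U. char_sign A r) * ((G 1 - G (-1)) / 2)"
    by (simp only: sum.distrib sum_distrib_right)
  then show ?thesis using sum_char_sign[OF assms] assms(1) by (simp add: card_Pow)
qed

text \<open>The sample space of \<open>m\<close> independent uniform parity checks. Extensional
  functions keep it finite, so expectations are sums.\<close>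

definition codes :: "nat \<Rightarrow> 'a set \<Rightarrow> (nat \<Rightarrow> 'a set) set" where
  "codes m U = {..<m} \<rightarrow>\<^sub>E Pow U"

lemma sum_codes_char_sign:
  fixes G :: "real \<Rightarrow> real"
  assumes "finite U" "A \<subseteq> U" "A \<noteq> {}"
  shows "(\<Sum>r\<in>codes m U. \<Prod>j<m. G (char_sign A (r j))) = real (card (codes m U)) * ((G 1 + G (-1)) / 2) ^ m"
proof -
  have "(\<Sum>r\<in>codes m U. \<Prod>j<m. G (char_sign A (r j))) = (\<Prod>j<m. \<Sum>r\<in>Pow U. G (char_sign A r))"
    unfolding codes_def by (rule prod_sum_PiE[symmetric]) (use assms in auto)
  then show ?thesis
    unfolding sum_fun_char_sign[OF assms] by (simp add: codes_def card_PiE card_Pow assms(1) flip: power_mult_distrib)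
qed

lemma exists_code_of_expectation:
  assumes "finite U" "(\<Sum>r\<in>codes m U. F r) < real (card (codes m U))"
  shows "\<exists>r\<in>codes m U. F r < 1"
proof (rule ccontr)
  assume "\<not> ?thesis"
  then have "(\<Sum>r\<in>codes m U. 1) \<le> (\<Sum>r\<in>codes m U. F r)" by (intro sum_mono) (auto simp: not_less)
  then show False using assms(2) by simp
qed

lemma card_codes_pos: "finite U \<Longrightarrow> 0 < card (codes m U)"
  by (simp add: codes_def card_PiE card_Pow)

text \<open>Random parity checks: a fixed nonempty set passes all \<open>m\<close> of them with probability \<open>2\<^sup>-\<^sup>m\<close>.\<close>

lemma exists_parity_checks:
  assumes U: "finite U" and Z: "finite Z" "\<And>z. z \<in> Z \<Longrightarrow> z \<subseteq> U \<and> z \<noteq> {}" and m: "card Z < 2 ^ m"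
  obtains r where "\<And>z. z \<in> Z \<Longrightarrow> \<exists>j<m. char_sign z (r j) = -1"
proof -
  let ?G = "\<lambda>s. of_bool (s = 1) :: real"
  have "(\<Sum>r\<in>codes m U. \<Sum>z\<in>Z. \<Prod>j<m. ?G (char_sign z (r j))) = (\<Sum>z\<in>Z. \<Sum>r\<in>codes m U. \<Prod>j<m. ?G (char_sign z (r j)))"
    by (rule sum.swap)
  also have "\<dots> = (\<Sum>z\<in>Z. real (card (codes m U)) * (1 / 2) ^ m)"
    by (intro sum.cong refl) (use sum_codes_char_sign[OF U, where G = ?G] Z in auto)
  also have "\<dots> = real (card (codes m U)) * (real (card Z) / 2 ^ m)"
    by (simp add: power_divide)
  also have "\<dots> < real (card (codes m U))"
  proof -
    have "real (card Z) < 2 ^ m" using m by (metis of_nat_less_iff of_nat_numeral of_nat_power)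
    then show ?thesis using card_codes_pos[OF U, of m] by (simp add: field_simps)
  qed
  finally obtain r where r: "(\<Sum>z\<in>Z. \<Prod>j<m. ?G (char_sign z (r j))) < 1"
    using exists_code_of_expectation[OF U] by blast
  have "\<exists>j<m. char_sign z (r j) = -1" if "z \<in> Z" for z
  proof (rule ccontr)
    assume "\<not> ?thesis"
    then have "(\<Prod>j<m. ?G (char_sign z (r j))) = 1"
      using char_sign_cases[of z] by (intro prod.neutral) fastforce
    moreover have "(\<Prod>j<m. ?G (char_sign z (r j))) \<le> (\<Sum>z\<in>Z. \<Prod>j<m. ?G (char_sign z (r j)))"
      by (rule member_le_sum[OF that]) (auto intro!: prod_nonneg Z)
    ultimately show False using r by linarith
  qed
  then show ?thesis using that by blast
qed

text \<open>A Chernoff bound for each nonempty set and a union bound over all of them. Since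
  \<open>D\<close> may be linear in \<open>n\<close>, a superposition over the positions needs only
  \<open>log n + O(1)\<close> qubits.\<close>

lemma exists_small_bias_code:
  assumes U: "finite U" "card U = n" and n: "1 \<le> n" and D: "64 * n \<le> D"
  obtains r where "\<And>z. z \<subseteq> U \<Longrightarrow> z \<noteq> {} \<Longrightarrow> \<bar>\<Sum>j<D. char_sign z (r j)\<bar> \<le> 3 / 8 * real D"
proof -
  \<comment> \<open>The value 3/16 minimises \<open>t^2 - 3/8 * t\<close>, with minimum
    \<open>-9/256\<close>. For \<open>D \<ge> 64 * n\<close> the exponent is at most
    \<open>- 9/4 * n\<close>, which beats the factor \<open>exp (2 * n)\<close> of the two-sided
    union bound.\<close>
  define t :: real where "t = 3 / 16"
  define c where "c = exp (- (t * (3 / 8 * real D)))"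
  define Z where "Z = Pow U - {{}}"
  let ?S = "\<lambda>r z. \<Sum>j<D. char_sign z (r j)"
  have mgf: "(\<Sum>r\<in>codes D U. exp (s * ?S r z)) = real (card (codes D U)) * ((exp s + exp (- s)) / 2) ^ D"
    if "z \<in> Z" for z s
    using sum_codes_char_sign[OF U(1), of z "\<lambda>x. exp (s * x)" D] that
    by (simp add: Z_def exp_sum sum_distrib_left)
  have "(\<Sum>r\<in>codes D U. \<Sum>z\<in>Z. c * (exp (t * ?S r z) + exp (- t * ?S r z)))
    = (\<Sum>z\<in>Z. c * ((\<Sum>r\<in>codes D U. exp (t * ?S r z)) + (\<Sum>r\<in>codes D U. exp (- t * ?S r z))))"
    unfolding sum.distrib[symmetric] sum_distrib_left by (rule sum.swap)
  also have "\<dots> = (\<Sum>z\<in>Z. c * (2 * (real (card (codes D U)) * ((exp t + exp (- t)) / 2) ^ D)))"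
    by (intro sum.cong refl) (simp only: mgf minus_minus add.commute[of "exp (- t)" "exp t"] mult_2)
  also have "\<dots> = real (card (codes D U)) * (real (card Z) * 2 * ((exp t + exp (- t)) / 2) ^ D * c)"
    by simp
  also have "\<dots> < real (card (codes D U)) * 1"
  proof (rule mult_strict_left_mono)
    have "card Z \<le> 2 ^ n" unfolding Z_def using U by (metis Diff_subset card_Pow card_mono finite_Pow_iff)
    then have "real (card Z) * 2 \<le> 2 ^ Suc n"
      by (metis mult.commute mult_le_mono2 of_nat_le_iff of_nat_mult of_nat_numeral of_nat_power power_Suc)
    also have "\<dots> \<le> exp 1 ^ Suc n"
      using exp_ge_add_one_self[of "1::real"] by (intro power_mono) auto
    also have "\<dots> = exp (real (Suc n))" by (metis exp_of_nat_mult mult.right_neutral)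
    also have "\<dots> \<le> exp (2 * real n)" using n by simp
    finally have Z2: "real (card Z) * 2 \<le> exp (2 * real n)" .
    have "((exp t + exp (- t)) / 2) ^ D \<le> exp (t\<^sup>2) ^ D"
      using two_cosh_le[of t] by (intro power_mono) (auto simp: t_def add_nonneg_nonneg)
    also have "\<dots> = exp (t\<^sup>2 * real D)" by (metis exp_of_nat_mult mult.commute)
    finally have "real (card Z) * 2 * ((exp t + exp (- t)) / 2) ^ D * c \<le> exp (2 * real n) * exp (t\<^sup>2 * real D) * c"
      using Z2 by (intro mult_mono mult_nonneg_nonneg) (auto simp: c_def add_nonneg_nonneg)
    also have "\<dots> = exp (2 * real n + t\<^sup>2 * real D - t * (3 / 8 * real D))"
      unfolding c_def exp_add[symmetric] by (simp only: diff_conv_add_uminus)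
    also have "\<dots> < exp 0"
    proof -
      have "64 * real n \<le> real D" using D by (metis of_nat_le_iff of_nat_mult of_nat_numeral)
      then have "2 * real n + t\<^sup>2 * real D - t * (3 / 8 * real D) < 0"
        using n by (simp add: t_def power2_eq_square)
      then show ?thesis by (simp only: exp_less_cancel_iff)
    qed
    finally show "real (card Z) * 2 * ((exp t + exp (- t)) / 2) ^ D * c < 1" by simp
    show "0 < real (card (codes D U))" using card_codes_pos[OF U(1)] by simp
  qed
  finally obtain r where r: "(\<Sum>z\<in>Z. c * (exp (t * ?S r z) + exp (- t * ?S r z))) < 1"
    using exists_code_of_expectation[OF U(1)] unfolding mult_1_right by blast
  have "\<bar>?S r z\<bar> \<le> 3 / 8 * real D" if "z \<subseteq> U" "z \<noteq> {}" for z
  proof (rule ccontr)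
    assume "\<not> ?thesis"
    then have "t * (3 / 8 * real D) \<le> t * \<bar>?S r z\<bar>" by (simp add: t_def)
    then have "exp (t * (3 / 8 * real D)) \<le> exp (t * \<bar>?S r z\<bar>)" by simp
    also have "\<dots> \<le> exp (t * ?S r z) + exp (- t * ?S r z)"
      by (cases "?S r z \<ge> 0") auto
    finally have "c * exp (t * (3 / 8 * real D)) \<le> c * (exp (t * ?S r z) + exp (- t * ?S r z))"
      by (simp add: c_def)
    then have "1 \<le> c * (exp (t * ?S r z) + exp (- t * ?S r z))"
      by (simp add: c_def exp_minus)
    also have "\<dots> \<le> (\<Sum>z\<in>Z. c * (exp (t * ?S r z) + exp (- t * ?S r z)))"
      by (rule member_le_sum) (use that U in \<open>auto simp: Z_def c_def intro!: mult_nonneg_nonneg add_nonneg_nonneg\<close>)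
    finally show False using r by simp
  qed
  then show ?thesis using that by blast
qed

text \<open>Each set arises by \<open>k\<close> insertions from the empty set, where the extra value
  \<open>n\<close> stands for inserting nothing; hence the base \<open>n + 1\<close>.\<close>

lemma card_small_subsets:
  "card {z. z \<subseteq> {..<n} \<and> card z \<le> k} \<le> (n + 1) ^ k"
proof (induction k)
  case 0
  have "{z. z \<subseteq> {..<n} \<and> card z \<le> 0} \<subseteq> {{}}" using finite_subset[of _ "{..<n}"] by auto
  then show ?case by (metis card.empty card_insert_disjoint card_mono empty_iff finite.emptyI finite_insert One_nat_def power_0)
next
  case (Suc k)
  let ?F = "\<lambda>k. {z. z \<subseteq> {..<n} \<and> card z \<le> k}"
  have "?F (Suc k) \<subseteq> (\<lambda>(z, i). z \<union> ({i} \<inter> {..<n})) ` (?F k \<times> {..n})"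
  proof
    fix z assume z: "z \<in> ?F (Suc k)"
    then have fin: "finite z" using finite_subset by blast
    show "z \<in> (\<lambda>(z, i). z \<union> ({i} \<inter> {..<n})) ` (?F k \<times> {..n})"
    proof (cases "z = {}")
      case True
      then show ?thesis by (intro image_eqI[of _ _ "({}, n)"]) auto
    next
      case False
      then obtain i where i: "i \<in> z" by blast
      then have "card (z - {i}) \<le> k" "i < n" using z fin by auto
      then show ?thesis using z i by (intro image_eqI[of _ _ "(z - {i}, i)"]) auto
    qed
  qed
  then have "card (?F (Suc k)) \<le> card (?F k \<times> {..n})"
    by (rule surj_card_le[rotated]) simp
  also have "\<dots> \<le> (n + 1) ^ k * (n + 1)"
    unfolding card_cartesian_product using Suc by (intro mult_mono) auto
  finally show ?case by (simp add: mult.commute)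
qed

subsection \<open>The Hamming distance problem\<close>

definition ones :: "bool list \<Rightarrow> nat set" where
  "ones x = {i. i < length x \<and> x ! i}"

definition bits :: "nat \<Rightarrow> nat set \<Rightarrow> bool list" where
  "bits n A = map (\<lambda>i. i \<in> A) [0..<n]"

lemma ones_bits: "A \<subseteq> {..<n} \<Longrightarrow> ones (bits n A) = A"
  by (auto simp: ones_def bits_def)

lemma bits_in: "bits n A \<in> bitstrings n"
  by (simp add: bits_def bitstrings_def)

lemma ones_subset: "x \<in> bitstrings n \<Longrightarrow> ones x \<subseteq> {..<n}"
  by (auto simp: ones_def bitstrings_def)

lemma bits_ones: "x \<in> bitstrings n \<Longrightarrow> bits n (ones x) = x"
  by (auto simp: ones_def bits_def bitstrings_def intro: nth_equalityI)

lemma HAM_iff: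
  assumes "x \<in> bitstrings n" "y \<in> bitstrings n"
  shows "HAM d x y \<longleftrightarrow> card (sym_diff (ones x) (ones y)) \<le> d"
proof -
  have "{i. i < length x \<and> x ! i \<noteq> y ! i} = sym_diff (ones x) (ones y)"
    using assms by (auto simp: ones_def bitstrings_def)
  then show ?thesis by (simp add: HAM_def hamming_dist_def)
qed

lemma HAM_bits:
  assumes "A \<subseteq> {..<n}" "B \<subseteq> {..<n}"
  shows "HAM d (bits n A) (bits n B) \<longleftrightarrow> card (sym_diff A B) \<le> d"
  using HAM_iff[OF bits_in bits_in] assms by (simp add: ones_bits)

lemma card_bitstrings: "card (bitstrings n) = 2 ^ n"
  using card_lists_length_eq[of "UNIV :: bool set" n] by (simp add: bitstrings_def)

text \<open>Let \<open>V\<close> be the difference of the two inputs and \<open>S\<close> a set of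
  size \<open>min d (n - card V)\<close> outside \<open>V\<close>. The string at difference
  \<open>S\<close> from \<open>x\<close> is within distance \<open>d\<close> of \<open>x\<close>,
  but its distance to \<open>x'\<close> is \<open>min (card V + d) n\<close>, which exceeds
  \<open>d\<close>.\<close>

lemma HAM_rows_distinct:
  assumes x: "x \<in> bitstrings n" "x' \<in> bitstrings n" and "x \<noteq> x'" "d < n"
  shows "\<exists>y\<in>bitstrings n. HAM d x y \<noteq> HAM d x' y"
proof -
  define A A' where "A = ones x" and "A' = ones x'"
  have sub: "A \<subseteq> {..<n}" "A' \<subseteq> {..<n}" using x ones_subset by (auto simp: A_def A'_def)
  define V where "V = sym_diff A A'"
  have V: "V \<subseteq> {..<n}" using sub by (auto simp: V_def)
  then have finV: "finite V" using finite_subset by blast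
  have "V \<noteq> {}" using \<open>x \<noteq> x'\<close> bits_ones[OF x(1)] bits_ones[OF x(2)] by (auto simp: V_def A_def A'_def)
  then have cV: "0 < card V" "card V \<le> n" using finV card_mono[OF _ V] by (auto simp: card_gt_0_iff)
  have "min d (n - card V) \<le> card ({..<n} - V)" using V finV by (simp add: card_Diff_subset)
  then obtain S where S: "S \<subseteq> {..<n} - V" "card S = min d (n - card V)" "finite S"
    by (metis obtain_subset_with_card_n)
  define C where "C = sym_diff A S"
  have C: "C \<subseteq> {..<n}" using sub S by (auto simp: C_def)
  have "sym_diff A C = S" by (auto simp: C_def)
  moreover have "sym_diff A' C = V \<union> S" using S(1) by (auto simp: C_def V_def)
  moreover have "card (V \<union> S) = card V + card S" using S finV by (intro card_Un_disjoint) auto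
  ultimately have "HAM d x (bits n C)" "\<not> HAM d x' (bits n C)"
    using HAM_iff[OF x(1) bits_in, of d C] HAM_iff[OF x(2) bits_in, of d C] S(2) cV \<open>d < n\<close>
    by (simp_all add: ones_bits[OF C] flip: A_def A'_def)
  then show ?thesis using bits_in by blast
qed

lemma HAM_log_bound:
  assumes "1 \<le> n" "d < n"
    and valid: "valid_protocol (bitstrings n) (bitstrings n) P" and comp: "computes (bitstrings n) (bitstrings n) P (HAM d)"
  shows "1 \<le> alice_qubits P" "log 2 (real n) \<le> 7 * real (alice_qubits P)"
proof -
  have x: "bits n {} \<noteq> bits n {0}"
    using ones_bits[of "{}" n] ones_bits[of "{0}" n] \<open>1 \<le> n\<close> by auto
  obtain y where "y \<in> bitstrings n" "HAM d (bits n {}) y \<noteq> HAM d (bits n {0}) y"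
    using HAM_rows_distinct[OF bits_in bits_in x \<open>d < n\<close>] by blast
  then show 1: "1 \<le> alice_qubits P"
    by (rule distinct_rows_alice_pos[OF valid comp bits_in bits_in])
  have "card (bitstrings n) \<le> (16 * (2 ^ alice_qubits P)\<^sup>2 + 1) ^ (2 * (2 ^ alice_qubits P)\<^sup>2)"
    by (rule distinct_rows_card_le[OF valid comp]) (use HAM_rows_distinct \<open>d < n\<close> in blast)
  then show "log 2 (real n) \<le> 7 * real (alice_qubits P)"
    unfolding card_bitstrings by (rule log_le_of_card_le[OF _ refl 1 \<open>1 \<le> n\<close>])
qed

text \<open>Reduction from the index problem: Alice encodes \<open>K\<close> bits \<open>b\<^sub>i\<close> by the balanced string
  \<open>b (\<not>b)\<close>, so that flipping position \<open>i\<close> changes its distance to \<open>0\<close> by \<open>\<plusminus>1\<close>; a block of \<open>d - K\<close> ones of Bob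
  moves the threshold to \<open>d\<close>.\<close>

lemma HAM_index_bound:
  assumes "d < n"
    and valid: "valid_protocol (bitstrings n) (bitstrings n) P" and comp: "computes (bitstrings n) (bitstrings n) P (HAM d)"
  shows "min d (n - d) \<le> 1300 * alice_qubits P"
proof -
  \<comment> \<open>The balanced string occupies \<open>2 * K\<close> positions and Bob's block
    \<open>d - K\<close> further ones, which fit because \<open>K + d \<le> n\<close>.\<close>
  define K where "K = min d (n - d)"
  have K: "K \<le> d" "K + d \<le> n" using \<open>d < n\<close> by (auto simp: K_def)
  define A where "A s = {i. i < K \<and> s i = 1} \<union> (\<lambda>i. K + i) ` {i. i < K \<and> s i \<noteq> 1}" for s :: "nat \<Rightarrow> real"
  define B where "B i = {i} \<union> {2 * K..<K + d}" for i
  have subA: "A s \<subseteq> {..<n}" for s using K by (auto simp: A_def)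
  have subB: "B i \<subseteq> {..<n}" if "i < K" for i using K that by (auto simp: B_def)
  have finA: "finite (A s)" for s using subA finite_subset by blast
  have cardA: "card (A s) = K" for s
  proof -
    have "card (A s) = card {i. i < K \<and> s i = 1} + card ((\<lambda>i. K + i) ` {i. i < K \<and> s i \<noteq> 1})"
      unfolding A_def by (rule card_Un_disjoint) auto
    also have "card ((\<lambda>i. K + i) ` {i. i < K \<and> s i \<noteq> 1}) = card {i. i < K \<and> s i \<noteq> 1}"
      by (rule card_image) (simp add: inj_on_def)
    also have "card {i. i < K \<and> s i = 1} + card {i. i < K \<and> s i \<noteq> 1} = card ({i. i < K \<and> s i = 1} \<union> {i. i < K \<and> s i \<noteq> 1})"
      by (rule card_Un_disjoint[symmetric]) auto
    also have "{i. i < K \<and> s i = 1} \<union> {i. i < K \<and> s i \<noteq> 1} = {..<K}" by auto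
    finally show ?thesis by simp
  qed
  have HAM: "HAM d (bits n (A s)) (bits n (B i)) \<longleftrightarrow> s i = 1" if i: "i < K" for s i
  proof -
    have mem: "i \<in> A s \<longleftrightarrow> s i = 1" using i by (auto simp: A_def)
    have "sym_diff (A s) (B i) = sym_diff (A s) {i} \<union> {2 * K..<K + d}"
      using i by (auto simp: A_def B_def)
    also have "card \<dots> = card (sym_diff (A s) {i}) + card {2 * K..<K + d}"
      by (rule card_Un_disjoint) (use i finA in \<open>auto simp: A_def\<close>)
    also have "card (sym_diff (A s) {i}) = (if s i = 1 then K - 1 else K + 1)"
    proof (cases "s i = 1")
      case True
      then have "sym_diff (A s) {i} = A s - {i}" using mem by auto
      then show ?thesis using True mem cardA finA by simp
    next
      case False
      then have "sym_diff (A s) {i} = insert i (A s)" using mem by auto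
      then show ?thesis using False mem cardA finA by simp
    qed
    \<comment> \<open>The distance is \<open>d - 1\<close> or \<open>d + 1\<close>, on either side
      of the threshold.\<close>
    finally have "card (sym_diff (A s) (B i)) = (if s i = 1 then K - 1 else K + 1) + (d - K)" by simp
    then show ?thesis using HAM_bits[OF subA subB[OF i], of d s] K i by auto
  qed
  have "1 \<le> n" using \<open>d < n\<close> by simp
  then have "1 \<le> alice_qubits P" by (rule HAM_log_bound(1)[OF _ \<open>d < n\<close> valid comp])
  then have "K \<le> 1300 * alice_qubits P"
    using index_qubits_bound[OF valid comp, of K "\<lambda>s. bits n (A s)" "\<lambda>i. bits n (B i)"] HAM bits_in by blast
  then show ?thesis by (simp add: K_def)
qed

text \<open>Alice and Bob send syndromes, from which the referee guesses the difference \<open>e\<close> of the inputs (unique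
  among sets of size at most \<open>d\<close>), and two copies of a fingerprint each. Multiplication by the character
  of \<open>e\<close> moves the fingerprint of \<open>x\<close> to that of \<open>x + e\<close>, and two swap tests compare it with
  that of \<open>y\<close>; they accept with probability \<open>((1 + c\<^sup>2) / 2)\<^sup>2\<close>, where \<open>c = 1\<close> or \<open>\<bar>c\<bar> \<le> 3 / 8\<close>.\<close>

lemma HAM_protocol:
  assumes n: "1 \<le> n" and l: "64 * n \<le> 2 ^ l"
  shows "\<exists>P. valid_protocol (bitstrings n) (bitstrings n) P \<and> computes (bitstrings n) (bitstrings n) P (HAM d)
    \<and> protocol_cost P = 4 * (2 * d * l + 1 + l)"
proof -
  define U where "U = {..<n}"
  define D :: nat where "D = 2 ^ l"
  \<comment> \<open>Two candidates of size at most \<open>d\<close> differ in at most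
    \<open>2 * d\<close> elements, so all sets in \<open>Z\<close> must fail some check. There are
    at most \<open>(n + 1) ^ (2 * d) \<le> 2 ^ (2 * d * l)\<close> of them.\<close>
  define m where "m = 2 * d * l + 1"
  define Z where "Z = {z. z \<subseteq> U \<and> card z \<le> 2 * d} - {{}}"
  have U: "finite U" "card U = n" by (simp_all add: U_def)
  have finF: "finite {z. z \<subseteq> U \<and> card z \<le> 2 * d}" using U(1) by (auto intro: finite_subset[of _ "Pow U"])
  have "card Z \<le> card {z. z \<subseteq> U \<and> card z \<le> 2 * d}" unfolding Z_def using finF by (intro card_mono) auto
  also have "\<dots> \<le> (n + 1) ^ (2 * d)" unfolding U_def by (rule card_small_subsets)
  also have "\<dots> \<le> (2 ^ l) ^ (2 * d)" using l n by (intro power_mono) auto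
  also have "\<dots> < 2 ^ m" by (simp add: m_def mult_ac flip: power_mult)
  finally have cardZ: "card Z < 2 ^ m" .
  obtain rc where rc: "\<And>z. z \<in> Z \<Longrightarrow> \<exists>j<m. char_sign z (rc j) = -1"
    by (rule exists_parity_checks[OF U(1) _ _ cardZ]) (use finF in \<open>auto simp: Z_def\<close>)
  obtain rf where rf: "\<And>z. z \<subseteq> U \<Longrightarrow> z \<noteq> {} \<Longrightarrow> \<bar>\<Sum>j<D. char_sign z (rf j)\<bar> \<le> 3 / 8 * real D"
    using exists_small_bias_code[OF U n, of D] l unfolding D_def by blast
  have Dpos: "0 < real D" by (simp add: D_def)
  define S where "S = Pow {..<m}"
  define R where "R = {..<D}"
  define syn where "syn A = {j. j < m \<and> char_sign A (rc j) = -1}" for A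
  define dec where "dec s s' e \<longleftrightarrow> e \<subseteq> U \<and> card e \<le> d \<and> syn e = sym_diff s s'" for s s' e
  define g where "g s s' \<longleftrightarrow> (\<exists>e. dec s s' e)" for s s'
  \<comment> \<open>Without a candidate, \<open>SOME\<close> yields arbitrary signs, and
    \<open>g\<close> makes the referee reject.\<close>
  define \<chi> where "\<chi> s s' j = char_sign (SOME e. dec s s' e) (rf j)" for s s' j
  define h where "h A j = char_sign A (rf j) / sqrt (real D)" for A j
  define T where "T = controlled_swap g \<chi>"
  define \<psi> where "\<psi> A = (\<lambda>p. of_bool (fst p = syn A) * h A (snd p))" for A
  have fin: "finite S" "finite R" by (simp_all add: S_def R_def)
  have synS: "syn A \<in> S" for A by (auto simp: syn_def S_def)
  have syn_sym_diff: "syn (sym_diff A B) = sym_diff (syn A) (syn B)" for A B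
  proof -
    have "char_sign A (rc j) * char_sign B (rc j) = -1 \<longleftrightarrow> (char_sign A (rc j) = -1) \<noteq> (char_sign B (rc j) = -1)" for j
      using char_sign_cases[of A "rc j"] char_sign_cases[of B "rc j"] by auto
    then show ?thesis unfolding syn_def char_sign_sym_diff by auto
  qed
  have hh: "h A j * h B j = char_sign A (rf j) * char_sign B (rf j) / real D" for A B j
    by (simp add: h_def)
  have h1: "(\<Sum>j\<in>R. (h A j)\<^sup>2) = 1" for A
    unfolding power2_eq_square hh using Dpos by (simp add: char_sign_square R_def)
  define c where "c A B = (\<Sum>j\<in>R. \<chi> (syn A) (syn B) j * h A j * h B j)" for A B
  have c: "c A B = (\<Sum>j<D. char_sign (sym_diff (SOME e. dec (syn A) (syn B) e) (sym_diff A B)) (rf j)) / real D" for A B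
    unfolding c_def \<chi>_def mult.assoc hh char_sign_sym_diff by (simp add: R_def sum_divide_distrib)
  have test: "projective_test (S \<times> R) (S \<times> R) T"
    unfolding T_def by (rule controlled_swap_test[OF fin]) (simp add: \<chi>_def char_sign_square)
  have acc: "acceptance (S \<times> R) (S \<times> R) T (\<psi> A) (\<psi> B) = of_bool (g (syn A) (syn B)) * ((1 + (c A B)\<^sup>2) / 2)" for A B
    unfolding T_def \<psi>_def c_def by (rule controlled_swap_acceptance[OF fin(1) synS synS fin(2) h1 h1])
  have good: "g (syn A) (syn B) \<and> c A B = 1" if sub: "A \<subseteq> U" "B \<subseteq> U" and close: "card (sym_diff A B) \<le> d" for A B
  proof -
    define e where "e = (SOME e. dec (syn A) (syn B) e)"
    have dec0: "dec (syn A) (syn B) (sym_diff A B)"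
      using sub close by (auto simp: dec_def syn_sym_diff)
    then have dec: "dec (syn A) (syn B) e" unfolding e_def by (rule someI)
    have "sym_diff e (sym_diff A B) = {}"
    proof (rule ccontr)
      assume ne: "sym_diff e (sym_diff A B) \<noteq> {}"
      have fine: "finite e" "finite (sym_diff A B)" using dec sub U(1) by (auto simp: dec_def intro: finite_subset)
      have "card (sym_diff e (sym_diff A B)) \<le> card (e \<union> sym_diff A B)"
        using fine by (intro card_mono) auto
      also have "\<dots> \<le> card e + card (sym_diff A B)" by (rule card_Un_le)
      also have "\<dots> \<le> 2 * d" using dec close by (simp add: dec_def)
      finally have "sym_diff e (sym_diff A B) \<in> Z" using ne dec sub unfolding Z_def dec_def by blast
      then obtain j where "j < m" "char_sign (sym_diff e (sym_diff A B)) (rc j) = -1" using rc by blast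
      then have "j \<in> syn (sym_diff e (sym_diff A B))" by (simp add: syn_def)
      then show False using dec by (auto simp: syn_sym_diff dec_def)
    qed
    then have "c A B = (\<Sum>j<D. char_sign {} (rf j)) / real D" unfolding c e_def[symmetric] by (simp only:)
    then have "c A B = 1" using Dpos by (simp add: char_sign_def)
    with dec0 show ?thesis by (auto simp: g_def)
  qed
  have bad: "acceptance (S \<times> R) (S \<times> R) T (\<psi> A) (\<psi> B) \<le> (1 + (3 / 8)\<^sup>2) / 2"
    if sub: "A \<subseteq> U" "B \<subseteq> U" and far: "\<not> card (sym_diff A B) \<le> d" for A B
  proof (cases "g (syn A) (syn B)")
    case True
    \<comment> \<open>A misleading syndrome does no harm: a decoded \<open>e\<close> has at most
      \<open>d\<close> elements, so it is not the true difference and the fingerprints reveal the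
      mismatch.\<close>
    define e where "e = (SOME e. dec (syn A) (syn B) e)"
    have dec: "dec (syn A) (syn B) e" using True unfolding g_def e_def by (rule someI_ex)
    then have "e \<noteq> sym_diff A B" using far by (auto simp: dec_def)
    then have "sym_diff e (sym_diff A B) \<noteq> {}" by blast
    moreover have "sym_diff e (sym_diff A B) \<subseteq> U" using dec sub unfolding dec_def by blast
    ultimately have "\<bar>c A B\<bar> \<le> 3 / 8"
      using rf[of "sym_diff e (sym_diff A B)"] Dpos unfolding c e_def[symmetric] by (simp add: field_simps)
    then have "(c A B)\<^sup>2 \<le> (3 / 8)\<^sup>2" unfolding abs_le_square_iff[symmetric] by simp
    then show ?thesis unfolding acc by simp
  qed (simp add: acc)
  have acc_nonneg: "0 \<le> acceptance (S \<times> R) (S \<times> R) T (\<psi> A) (\<psi> B)" for A B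
    unfolding acc by (simp add: add_nonneg_nonneg)
  let ?I = "(S \<times> R) \<times> (S \<times> R)"
  define T2 where "T2 = (\<lambda>((i1, i2), (j1, j2)) ((i1', i2'), (j1', j2')). T (i1, j1) (i1', j1') * T (i2, j2) (i2', j2'))"
  define \<psi>2 where "\<psi>2 x = (\<lambda>(p, q). \<psi> (ones x) p * \<psi> (ones x) q)" for x
  note test2 = square_test(1)[OF test, folded T2_def]
  have acc2: "acceptance ?I ?I T2 (\<psi>2 x) (\<psi>2 y) = (acceptance (S \<times> R) (S \<times> R) T (\<psi> (ones x)) (\<psi> (ones y)))\<^sup>2" for x y
    unfolding \<psi>2_def by (rule square_test(2)[OF test, folded T2_def])
  \<comment> \<open>The whole state is doubled, syndrome included, so each player sends
    \<open>2 * (m + l)\<close> qubits.\<close>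
  have cardI: "card ?I = 2 ^ (2 * (m + l))"
    unfolding mult_2 power_add by (simp add: card_cartesian_product S_def R_def D_def card_Pow)
  have unit: "(\<Sum>p\<in>?I. (\<psi>2 x p)\<^sup>2) = 1" for x
  proof -
    have "(\<Sum>p\<in>?I. (\<psi>2 x p)\<^sup>2) = (\<Sum>p\<in>S \<times> R. (\<psi> (ones x) p)\<^sup>2) * (\<Sum>p\<in>S \<times> R. (\<psi> (ones x) p)\<^sup>2)"
      unfolding sum_product sum.cartesian_product by (intro sum.cong refl) (auto simp: \<psi>2_def power_mult_distrib)
    also have "(\<Sum>p\<in>S \<times> R. (\<psi> (ones x) p)\<^sup>2) = 1"
      unfolding \<psi>_def by (rule controlled_swap_state[OF fin(1) synS h1])
    finally show ?thesis by simp
  qed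
  have "\<exists>P. valid_protocol (bitstrings n) (bitstrings n) P \<and> computes (bitstrings n) (bitstrings n) P (HAM d)
    \<and> protocol_cost P = 2 * (m + l) + 2 * (m + l)"
  proof (rule smp_protocol_of_test[OF _ cardI _ cardI test2 unit unit])
    show "finite ?I" "finite ?I" using fin by auto
    fix x y assume xy: "x \<in> bitstrings n" "y \<in> bitstrings n"
    have sub: "ones x \<subseteq> U" "ones y \<subseteq> U" using xy ones_subset by (auto simp: U_def)
    show "2 / 3 \<le> acceptance ?I ?I T2 (\<psi>2 x) (\<psi>2 y)" if "HAM d x y"
      using good[OF sub] that unfolding acc2 acc HAM_iff[OF xy] by simp
    show "acceptance ?I ?I T2 (\<psi>2 x) (\<psi>2 y) \<le> 1 / 3" if "\<not> HAM d x y"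
    proof -
      have "(acceptance (S \<times> R) (S \<times> R) T (\<psi> (ones x)) (\<psi> (ones y)))\<^sup>2 \<le> ((1 + (3 / 8)\<^sup>2) / 2)\<^sup>2"
        using bad[OF sub] that acc_nonneg unfolding HAM_iff[OF xy] by (intro power_mono) auto
      \<comment> \<open>The left side is \<open>(73/128)^2\<close>, about 0.325.\<close>
      also have "\<dots> \<le> 1 / 3" by (simp add: power2_eq_square)
      finally show ?thesis unfolding acc2 .
    qed
  qed
  moreover have "2 * (m + l) + 2 * (m + l) = 4 * (2 * d * l + 1 + l)" by (simp add: m_def)
  ultimately show ?thesis by (simp only:)
qed

section \<open>The minimal cost and the two final bounds\<close>

lemma quantum_smp_complexity_le:
  assumes "valid_protocol X Y P" "computes X Y P f"
  shows "quantum_smp_complexity X Y f \<le> protocol_cost P"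
  unfolding quantum_smp_complexity_def by (rule Least_le) (use assms in blast)

text \<open>\<open>LEAST\<close> is informative only if some protocol exists; in the lower bound the
  protocol of the upper bound serves as \<open>P0\<close>.\<close>

lemma quantum_smp_complexity_attained:
  assumes "valid_protocol X Y P0" "computes X Y P0 f"
  obtains P where "valid_protocol X Y P" "computes X Y P f" "protocol_cost P = quantum_smp_complexity X Y f"
proof -
  have "\<exists>P. valid_protocol X Y P \<and> computes X Y P f \<and> protocol_cost P = quantum_smp_complexity X Y f"
    unfolding quantum_smp_complexity_def
    by (rule LeastI[of "\<lambda>c. \<exists>P. valid_protocol X Y P \<and> computes X Y P f \<and> protocol_cost P = c"]) (use assms in blast)
  then show ?thesis using that by blast
qed

text \<open>The referee accepts without receiving any qubits. This settles \<open>n = 1\<close>,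
  where the claimed upper bound is 0.\<close>

lemma quantum_smp_complexity_const:
  assumes "\<And>x y. x \<in> X \<Longrightarrow> y \<in> Y \<Longrightarrow> f x y"
  shows "quantum_smp_complexity X Y f = 0"
proof -
  have "\<exists>P. valid_protocol X Y P \<and> computes X Y P f \<and> protocol_cost P = 0 + 0"
    by (rule smp_protocol_of_test[of "UNIV :: unit set" _ "UNIV :: unit set" _ "\<lambda>_ _. 1" X "\<lambda>_ _. 1" Y "\<lambda>_ _. 1"])
      (use assms in \<open>auto simp: projective_test_def acceptance_def UNIV_unit\<close>)
  then show ?thesis using quantum_smp_complexity_le by fastforce
qed

text \<open>Here 7 is \<open>log 2 64 = 6\<close> plus 1 for rounding up; 64 is the length factor of
  the small-bias code.\<close>

lemma log_sandwich:
  assumes "1 \<le> n"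
  obtains l where "64 * n \<le> 2 ^ l" "real l \<le> 7 + log 2 (real n)"
proof
  define l where "l = nat \<lceil>log 2 (64 * real n)\<rceil>"
  have "log 2 (64 * real n) = log 2 (2 ^ 6) + log 2 (real n)"
    using assms by (simp add: log_mult)
  also have "log 2 (2 ^ 6) = (6 :: real)" by (subst log_nat_power) auto
  finally have L: "log 2 (64 * real n) = 6 + log 2 (real n)" .
  have "0 \<le> log 2 (real n)" using assms by simp
  then show "real l \<le> 7 + log 2 (real n)" using L unfolding l_def by linarith
  have "64 * real n = 2 powr (log 2 (64 * real n))" using assms by simp
  also have "\<dots> \<le> 2 powr real l" unfolding l_def by (intro powr_mono) (auto simp: of_nat_nat real_nat_ceiling_ge)
  also have "\<dots> = 2 ^ l" by (simp add: powr_realpow)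
  finally show "64 * n \<le> 2 ^ l" by (metis of_nat_le_iff of_nat_mult of_nat_numeral of_nat_power)
qed

text \<open>From \<open>d \<le> \<alpha> * n\<close> follows
  \<open>n - d \<ge> (1 - \<alpha>) * n \<ge> (1 - \<alpha>) * d\<close>, so the index bound is
  linear in \<open>d\<close>. The constant 1307 is \<open>1300 + 7\<close>, the sum of the two
  bounds on Alice's qubits.\<close>

lemma HAM_lower_bound:
  fixes \<alpha> :: real
  assumes \<alpha>: "\<alpha> < 1" and n: "1 \<le> n" and d: "real d \<le> \<alpha> * real n"
  shows "min 1 (1 - \<alpha>) / 1307 * (real d + log 2 (real n)) \<le> real (Q_HAM n d)"
proof -
  have "\<alpha> * real n < 1 * real n" using \<alpha> n by (intro mult_strict_right_mono) auto
  then have "d < n" using d by simp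
  obtain l where "64 * n \<le> 2 ^ l" using log_sandwich[OF n] by blast
  then obtain P0 where "valid_protocol (bitstrings n) (bitstrings n) P0" "computes (bitstrings n) (bitstrings n) P0 (HAM d)"
    using HAM_protocol[OF n] by blast
  then obtain P where P: "valid_protocol (bitstrings n) (bitstrings n) P" "computes (bitstrings n) (bitstrings n) P (HAM d)"
    and cost: "protocol_cost P = Q_HAM n d"
    by (rule quantum_smp_complexity_attained)
  define a where "a = real (alice_qubits P)"
  define \<gamma> where "\<gamma> = min 1 (1 - \<alpha>)"
  have \<gamma>: "0 < \<gamma>" "\<gamma> \<le> 1" "\<gamma> \<le> 1 - \<alpha>" using \<alpha> by (auto simp: \<gamma>_def)
  have logb: "log 2 (real n) \<le> 7 * a" using HAM_log_bound(2)[OF n \<open>d < n\<close> P] by (simp add: a_def)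
  have "real (min d (n - d)) \<le> real (1300 * alice_qubits P)"
    using HAM_index_bound[OF \<open>d < n\<close> P] by (simp only: of_nat_le_iff)
  then have idx: "min (real d) (real n - real d) \<le> 1300 * a"
    using \<open>d < n\<close> by (simp add: a_def of_nat_diff of_nat_min)
  have "\<gamma> * real d \<le> 1 * real d" using \<gamma> by (intro mult_right_mono) auto
  moreover have "\<gamma> * real d \<le> (1 - \<alpha>) * real n" using \<gamma> \<alpha> \<open>d < n\<close> by (intro mult_mono) auto
  then have "\<gamma> * real d \<le> real n - real d" using d by (simp add: left_diff_distrib)
  ultimately have 1: "\<gamma> * real d \<le> 1300 * a" using idx by simp
  have "\<gamma> * log 2 (real n) \<le> 1 * log 2 (real n)" using \<gamma> n by (intro mult_right_mono) auto
  then have "\<gamma> / 1307 * (real d + log 2 (real n)) \<le> a" using 1 logb by (simp add: distrib_left)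
  also have "a \<le> real (Q_HAM n d)" unfolding cost[symmetric] a_def protocol_cost_def by simp
  finally show ?thesis by (simp add: \<gamma>_def)
qed

text \<open>The constant is \<open>16 * 8\<close>: for \<open>d \<ge> 1\<close> the cost is at most
  \<open>16 * d * l\<close>, and for \<open>n \<ge> 2\<close> one has
  \<open>l \<le> 7 + log n \<le> 8 * log n\<close>.\<close>

lemma HAM_upper_bound:
  assumes n: "1 \<le> n" and d: "1 \<le> d"
  shows "real (Q_HAM n d) \<le> 128 * (real d * log 2 (real n) * min (real d) (log 2 (real n)))"
proof (cases "n = 1")
  case True
  have "HAM d x y" if "x \<in> bitstrings n" "y \<in> bitstrings n" for x y
  proof -
    have "card (sym_diff (ones x) (ones y)) \<le> card {..<n}"
      using ones_subset[OF that(1)] ones_subset[OF that(2)] by (intro card_mono) auto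
    then show ?thesis using HAM_iff[OF that] True d by simp
  qed
  then have "Q_HAM n d = 0" by (rule quantum_smp_complexity_const)
  then show ?thesis using True by simp
next
  case False
  then have n2: "2 \<le> real n" using n by simp
  then have L: "1 \<le> log 2 (real n)" by simp
  obtain l where l: "64 * n \<le> 2 ^ l" "real l \<le> 7 + log 2 (real n)" using log_sandwich[OF n] by blast
  have "1 \<le> l" using l(1) n by (cases l) auto
  have "Q_HAM n d \<le> 4 * (2 * d * l + 1 + l)"
    using HAM_protocol[OF n l(1)] quantum_smp_complexity_le by metis
  also have "\<dots> \<le> 16 * (d * l)"
  proof -
    have "1 \<le> d * l" "l \<le> d * l" using d \<open>1 \<le> l\<close> by simp_all
    moreover have "4 * (2 * q + 1 + l) \<le> 16 * q" if "1 \<le> q" "l \<le> q" for q :: nat using that by simp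
    ultimately show ?thesis unfolding mult.assoc by blast
  qed
  finally have "real (Q_HAM n d) \<le> real (16 * (d * l))" by (simp only: of_nat_le_iff)
  also have "\<dots> = 16 * (real d * real l)" by simp
  also have "\<dots> \<le> 16 * (real d * (8 * log 2 (real n)))"
    using l(2) L by (intro mult_left_mono) auto
  also have "\<dots> = 128 * (real d * log 2 (real n) * 1)" by simp
  also have "\<dots> \<le> 128 * (real d * log 2 (real n) * min (real d) (log 2 (real n)))"
    using L d by (intro mult_left_mono) auto
  finally show ?thesis .
qed

text \<open>The ratio \<open>\<alpha>\<close> stays below 1 because for \<open>d \<ge> n\<close> the
  problem is constant and costs nothing. The upper bound starts at \<open>d = 1\<close> because for
  \<open>d = 0\<close> its right side vanishes, while equality needs communication.\<close>

theorem theorem5: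
  shows "(\<forall>\<alpha>::real. \<alpha> < 1 \<longrightarrow>
            (\<exists>c>0. \<forall>n\<ge>1. \<forall>d. real d \<le> \<alpha> * real n \<longrightarrow>
               c * (real d + log 2 (real n)) \<le> real (Q_HAM n d)))
       \<and> (\<exists>C>0. \<forall>n\<ge>1. \<forall>d\<ge>1.
            real (Q_HAM n d) \<le> C * (real d * log 2 (real n) * min (real d) (log 2 (real n))))"
proof (intro conjI allI impI)
  fix \<alpha> :: real
  assume \<alpha>: "\<alpha> < 1"
  then have "0 < min 1 (1 - \<alpha>) / 1307" by simp
  then show "\<exists>c>0. \<forall>n\<ge>1. \<forall>d. real d \<le> \<alpha> * real n \<longrightarrow> c * (real d + log 2 (real n)) \<le> real (Q_HAM n d)"
    using HAM_lower_bound[OF \<alpha>] by blast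
next
  have "(0 :: real) < 128" by simp
  then show "\<exists>C>0. \<forall>n\<ge>1. \<forall>d\<ge>1. real (Q_HAM n d) \<le> C * (real d * log 2 (real n) * min (real d) (log 2 (real n)))"
    using HAM_upper_bound by blast
qed

end
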